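(* (Characterisation of Kantorovich distance.) Let $C,D$ be almost surely terminating statements, $R\subseteq\mathrm{Mem}\times\mathrm{Mem}$, $\Phi:\mathrm{Mem}\times\mathrm{Mem}\to[0,\infty]$, and let $\delta:\mathrm{Mem}\times\mathrm{Mem}\to[0,h]$ be a metric with $0\le h<\infty$. Let $L_1$ be the set of functions $f:\mathrm{Mem}\to\mathbb{R}$ that are $1$-Lipschitz with respect to $\delta$. The following are equivalent: (1) the eRHL judgment $\vdash_{L_1}\{R\triangleright(\Phi+h)\}\ C\sim D\ \{\lambda f\,(m_1,m_2).\ f(m_1)-f(m_2)+h\}$ (logical variable $f$ ranging over $L_1$) is derivable; (2) $W_1^\delta([\![C]\!]_{m_1},[\![D]\!]_{m_2})\le\Phi(m_1,m_2)$ for all $(m_1,m_2)\in R$.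
   Context: Kantorovich distance: for full distributions $d_1,d_2$ on $\mathrm{Mem}$, $W_1^\delta(d_1,d_2)=\inf_{\mu}\mathbb{E}_{(a_1,a_2)\sim\mu}[\delta(a_1,a_2)]$, infimum over couplings $\mu$ of $d_1,d_2$. (The post-assertion in (1) is nonnegative since $|f(m_1)-f(m_2)|\le\delta(m_1,m_2)\le h$.) Language. Fix a countable set $\mathrm{Var}$ of program variables and a countable set $\mathrm{Val}$ of values; a memory is a map $m:\mathrm{Var}\to\mathrm{Val}$, and $\mathrm{Mem}$ is the (discrete) set of memories; $m[x\mapsto v]$ is the update of $m$. For a countable set $A$, a sub-distribution is $d:A\to[0,1]$ with $|d|:=\sum_a d(a)\le1$ (full if $|d|=1$); $\mathbb{E}_d[f]:=\sum_a d(a)f(a)\in[0,\infty]$; $\delta_a$ is the Dirac distribution. Statements: $C ::= \mathtt{skip} \mid x\leftarrow e \mid x \xleftarrow{\$} s \mid C;C \mid \mathtt{if}\ b\ \mathtt{then}\ C\ \mathtt{else}\ C \mid \mathtt{while}\ b\ \mathtt{do}\ C$, with $[\![e]\!]_m\in\mathrm{Val}$, $[\![b]\!]_m\in\{\mathrm{true},\mathrm{false}\}$, $[\![s]\!]_m$ a full distribution on $\mathrm{Val}$. Semantics $[\![C]\!]_m$ (sub-distribution on $\mathrm{Mem}$): $[\![\mathtt{skip}]\!]_m=\delta_m$; $[\![x\leftarrow e]\!]_m=\delta_{m[x\mapsto[\![e]\!]_m]}$; $[\![x\xleftarrow{\$}s]\!]_m$ is the image of $[\![s]\!]_m$ under $v\mapsto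 m[x\mapsto v]$; $[\![C;D]\!]_m=\sum_{m'}[\![C]\!]_m(m')[\![D]\!]_{m'}$; conditionals select a branch by $[\![b]\!]_m$; $[\![\mathtt{while}\ b\ \mathtt{do}\ C]\!]_m=\sup_i[\![\mathtt{while}^i]\!]_m$ with $\mathtt{while}^0$ the zero sub-distribution and $[\![\mathtt{while}^{i+1}]\!]_m=\sum_{m'}[\![C]\!]_m(m')[\![\mathtt{while}^i]\!]_{m'}$ if $[\![b]\!]_m$, else $\delta_m$. $C$ is almost surely terminating (a.s.t.) if $[\![C]\!]_m$ is full for all $m$. Sequencing is taken with $\mathtt{skip}$ as syntactic unit. $\star$-couplings: $A^\star=A\uplus\{\star\}$; $d^\star$ extends $d$ by $d^\star(\star)=1-|d|$; a $\star$-coupling of $d_1,d_2$ is a full distribution on $A_1^\star\times A_2^\star$ with marginals $d_1^\star,d_2^\star$; a coupling of $d_1,d_2$ is a sub-distribution on $A_1\times A_2$ with marginals $d_1,d_2$. For $\Psi:Z\to\mathrm{Mem}\times\mathrm{Mem}\to[0,\infty]$, $\Psi^\star z(m_1,m_2)=\Psi z(m_1,m_2)$ if $m_1,m_2\in\mathrm{Mem}$, else $0$. For a predicate $P$ on $\mathrm{Mem}\times\mathrm{Mem}$, $P\triangleright\Phi$ equals $\Phi$ where $P$ holds and $\infty$ elsewhere; $[P]$ is the $0/1$ indicator. Write $b_1:=[\![b]\!]_{m_1}$, $b'_2:=[\![b']\!]_{m_2}$. Deductive system eRHL: judgments $\vdash_Z\{\Phi\}C\sim D\{\Psi\}$ ($Z$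 nonempty) are derivable if obtained by the rules: (Skip) $\vdash_Z\{\Phi\}\mathtt{skip}\sim\mathtt{skip}\{\Phi\}$. (Asgn) $\vdash_Z\{\lambda z(m_1,m_2).\Phi z(m_1[x\mapsto[\![e]\!]_{m_1}],m_2[y\mapsto[\![e']\!]_{m_2}])\}\ x\leftarrow e\sim y\leftarrow e'\ \{\Phi\}$. (Sample) if $\mu(m_1,m_2)$ is a coupling of $[\![s]\!]_{m_1},[\![s']\!]_{m_2}$ for all $m_1,m_2$: $\vdash_Z\{\lambda z(m_1,m_2).\mathbb{E}_{(v_1,v_2)\sim\mu(m_1,m_2)}[\Phi z(m_1[x\mapsto v_1],m_2[y\mapsto v_2])]\}\ x\xleftarrow{\$}s\sim y\xleftarrow{\$}s'\ \{\Phi\}$. (If) from $\vdash_Z\{(b_1\wedge b'_2)\triangleright\Phi\}C_1\sim D_1\{\Psi\}$ and $\vdash_Z\{(\neg b_1\wedge\neg b'_2)\triangleright\Phi\}C_2\sim D_2\{\Psi\}$ infer $\vdash_Z\{(b_1\leftrightarrow b'_2)\triangleright\Phi\}\ \mathtt{if}\ b\ \mathtt{then}\ C_1\ \mathtt{else}\ C_2\sim\mathtt{if}\ b'\ \mathtt{then}\ D_1\ \mathtt{else}\ D_2\ \{\Psi\}$. (While) from $\vdash_Z\{(b_1\wedge b'_2)\triangleright\Phi\}C\sim D\{(b_1\leftrightarrow b'_2)\triangleright\Phi\}$ infer $\vdash_Z\{(b_1\leftrightarrow b'_2)\triangleright\Phi\}\ \mathtt{while}\ b\ \mathtt{do}\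 C\sim\mathtt{while}\ b'\ \mathtt{do}\ D\ \{(\neg b_1\wedge\neg b'_2)\triangleright\Phi\}$. (Seq) from $\vdash_Z\{\Phi\}C_1\sim D_1\{\Theta\}$ and $\vdash_Z\{\Theta\}C_2\sim D_2\{\Psi\}$ infer $\vdash_Z\{\Phi\}C_1;C_2\sim D_1;D_2\{\Psi\}$ (with $\mathtt{skip}$ as unit). (Asgn-L) $\vdash_Z\{\lambda z(m_1,m_2).\Phi z(m_1[x\mapsto[\![e]\!]_{m_1}],m_2)\}\ x\leftarrow e\sim\mathtt{skip}\ \{\Phi\}$. (Sample-L) $\vdash_Z\{\lambda z(m_1,m_2).\mathbb{E}_{v\sim[\![s]\!]_{m_1}}[\Phi z(m_1[x\mapsto v],m_2)]\}\ x\xleftarrow{\$}s\sim\mathtt{skip}\ \{\Phi\}$. (If-L) from $\vdash_Z\{b_1\triangleright\Phi\}C_1\sim\mathtt{skip}\{\Psi\}$ and $\vdash_Z\{\neg b_1\triangleright\Phi\}C_2\sim\mathtt{skip}\{\Psi\}$ infer $\vdash_Z\{\Phi\}\mathtt{if}\ b\ \mathtt{then}\ C_1\ \mathtt{else}\ C_2\sim\mathtt{skip}\{\Psi\}$. (While-L) from $\vdash_Z\{b_1\triangleright\Phi\}C\sim\mathtt{skip}\{\Phi\}$ infer $\vdash_Z\{\Phi\}\mathtt{while}\ b\ \mathtt{do}\ C\sim\mathtt{skip}\{\neg b_1\triangleright\Phi\}$. (Conseq) from $\vdash_{Z'}\{\Phi'\}C\sim D\{\Psi'\}$ infer $\vdash_Z\{\Phi\}C\sim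 D\{\Psi\}$ provided: for all $m_1,m_2\in\mathrm{Mem}$ and sub-distributions $d_1,d_2$ on $\mathrm{Mem}$, if $\Phi'z'(m_1,m_2)\ge\inf_\mu\mathbb{E}_\mu[\Psi'^\star z']$ for all $z'\in Z'$ then $\Phi z(m_1,m_2)\ge\inf_\mu\mathbb{E}_\mu[\Psi^\star z]$ for all $z\in Z$ (infima over $\star$-couplings $\mu$ of $d_1,d_2$). (Nmod-L) if $x$ is not modified by $C$ ($m'(x)=m(x)$ whenever $m'\in\mathrm{supp}[\![C]\!]_m$), from $\vdash_{\mathrm{Val}\times Z}\{\lambda(v,z)(m_1,m_2).(m_1(x)=v)\triangleright\Phi z(m_1,m_2)\}C\sim D\{\lambda(v,z)(m_1,m_2).\Psi z(m_1[x\mapsto v],m_2)\}$ infer $\vdash_Z\{\Phi\}C\sim D\{\Psi\}$. (Strassen) if $C,D$ are a.s.t. and $R_z\subseteq\mathrm{Mem}\times\mathrm{Mem}$ ($z\in Z$), with $R_z(M)=\{m_2\mid\exists m_1\in M,(m_1,m_2)\in R_z\}$, then $\vdash_Z\{\Phi\}C\sim D\{\lambda z(m_1,m_2).[(m_1,m_2)\notin R_z]\}$ and $\vdash_{\mathcal{P}(\mathrm{Mem})\times Z}\{\lambda(M,z)(m_1,m_2).1+\Phi z(m_1,m_2)\}C\sim D\{\lambda(M,z)(m_1,m_2).[m_1\in M]+[m_2\notin R_z(M)]\}$ are each inferable from the other. Moreover, Asgn-L, Sample-L, If-L, While-L and Nmod-L have mirrored right versions with the roles of the two programs and of the two memory arguments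 swapped. *)

theory Defs
  imports "HOL-Probability.Probability"
begin

type_synonym ('x, 'v) mem = "'x \<Rightarrow> 'v"

text \<open>
  Expressions, guards and samplers stay abstract: they are elements of arbitrary types
  \<open>'e\<close>, \<open>'b\<close>, \<open>'s\<close>, interpreted by functions \<open>\<E>\<close>, \<open>\<B>\<close>, \<open>\<S>\<close> that are passed around explicitly.
\<close>

datatype ('x, 'e, 'b, 's) stmt =
    Skip
  | Assign 'x 'e
  | Sample 'x 's
  | Seq "('x, 'e, 'b, 's) stmt" "('x, 'e, 'b, 's) stmt"
  | Cond 'b "('x, 'e, 'b, 's) stmt" "('x, 'e, 'b, 's) stmt"
  | While 'b "('x, 'e, 'b, 's) stmt"

text \<open>
  Sub-distributions are \<^typ>\<open>'a spmf\<close>. Since \<^typ>\<open>'a spmf\<close> is \<^typ>\<open>'a option pmf\<close>, the element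
  \<^const>\<open>None\<close> plays the role of \<open>\<star>\<close>, and an \<open>spmf\<close> \<open>d\<close>, read as a \<open>pmf\<close>, is its own extension
  \<open>d\<^sup>\<star>\<close>; \<^term>\<open>return_pmf None\<close> is the zero sub-distribution.
\<close>

primrec while_approx ::
  "(('x, 'v) mem \<Rightarrow> bool) \<Rightarrow> (('x, 'v) mem \<Rightarrow> ('x, 'v) mem spmf) \<Rightarrow> nat
    \<Rightarrow> ('x, 'v) mem \<Rightarrow> ('x, 'v) mem spmf" where
  "while_approx g c 0 = (\<lambda>m. return_pmf None)"
| "while_approx g c (Suc i) =
     (\<lambda>m. if g m then bind_spmf (c m) (while_approx g c i) else return_spmf m)"

primrec sem ::
  "('e \<Rightarrow> ('x, 'v) mem \<Rightarrow> 'v) \<Rightarrow> ('b \<Rightarrow> ('x, 'v) mem \<Rightarrow> bool) \<Rightarrow> ('s \<Rightarrow> ('x, 'v) mem \<Rightarrow> 'v pmf)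
    \<Rightarrow> ('x, 'e, 'b, 's) stmt \<Rightarrow> ('x, 'v) mem \<Rightarrow> ('x, 'v) mem spmf" where
  "sem \<E> \<B> \<S> Skip = (\<lambda>m. return_spmf m)"
| "sem \<E> \<B> \<S> (Assign x e) = (\<lambda>m. return_spmf (m(x := \<E> e m)))"
| "sem \<E> \<B> \<S> (Sample x s) = (\<lambda>m. map_spmf (\<lambda>v. m(x := v)) (spmf_of_pmf (\<S> s m)))"
| "sem \<E> \<B> \<S> (Seq C D) = (\<lambda>m. bind_spmf (sem \<E> \<B> \<S> C m) (sem \<E> \<B> \<S> D))"
| "sem \<E> \<B> \<S> (Cond b C D) = (\<lambda>m. if \<B> b m then sem \<E> \<B> \<S> C m else sem \<E> \<B> \<S> D m)"
| "sem \<E> \<B> \<S> (While b C) =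
     (\<lambda>m. lub_spmf (range (\<lambda>i. while_approx (\<B> b) (sem \<E> \<B> \<S> C) i m)))"

definition ast ::
  "('e \<Rightarrow> ('x, 'v) mem \<Rightarrow> 'v) \<Rightarrow> ('b \<Rightarrow> ('x, 'v) mem \<Rightarrow> bool) \<Rightarrow> ('s \<Rightarrow> ('x, 'v) mem \<Rightarrow> 'v pmf)
    \<Rightarrow> ('x, 'e, 'b, 's) stmt \<Rightarrow> bool" where
  "ast \<E> \<B> \<S> C \<longleftrightarrow> (\<forall>m. lossless_spmf (sem \<E> \<B> \<S> C m))"

definition not_modified ::
  "('e \<Rightarrow> ('x, 'v) mem \<Rightarrow> 'v) \<Rightarrow> ('b \<Rightarrow> ('x, 'v) mem \<Rightarrow> bool) \<Rightarrow> ('s \<Rightarrow> ('x, 'v) mem \<Rightarrow> 'v pmf)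
    \<Rightarrow> 'x \<Rightarrow> ('x, 'e, 'b, 's) stmt \<Rightarrow> bool" where
  "not_modified \<E> \<B> \<S> x C \<longleftrightarrow> (\<forall>m. \<forall>m' \<in> set_spmf (sem \<E> \<B> \<S> C m). m' x = m x)"

text \<open>
  Sequencing has \<open>Skip\<close> as syntactic unit, i.e. statements are taken modulo the congruence
  generated by \<open>Seq Skip C = C\<close> and \<open>Seq C Skip = C\<close>. Two statements are congruent iff they have
  the same \<open>unit_nf\<close>.
\<close>

definition seq_unit ::
  "('x, 'e, 'b, 's) stmt \<Rightarrow> ('x, 'e, 'b, 's) stmt \<Rightarrow> ('x, 'e, 'b, 's) stmt" where
  "seq_unit C D = (if C = Skip then D else if D = Skip then C else Seq C D)"

primrec unit_nf :: "('x, 'e, 'b, 's) stmt \<Rightarrow> ('x, 'e, 'b, 's) stmt" where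
  "unit_nf Skip = Skip"
| "unit_nf (Assign x e) = Assign x e"
| "unit_nf (Sample x s) = Sample x s"
| "unit_nf (Seq C D) = seq_unit (unit_nf C) (unit_nf D)"
| "unit_nf (Cond b C D) = Cond b (unit_nf C) (unit_nf D)"
| "unit_nf (While b C) = While b (unit_nf C)"

definition couplings :: "'a spmf \<Rightarrow> 'b spmf \<Rightarrow> ('a \<times> 'b) spmf set" where
  "couplings d1 d2 = {\<mu>. map_spmf fst \<mu> = d1 \<and> map_spmf snd \<mu> = d2}"

definition star_couplings :: "'a spmf \<Rightarrow> 'b spmf \<Rightarrow> ('a option \<times> 'b option) pmf set" where
  "star_couplings d1 d2 = {\<mu>. map_pmf fst \<mu> = d1 \<and> map_pmf snd \<mu> = d2}"

definition star_ext :: "('a \<times> 'b \<Rightarrow> ennreal) \<Rightarrow> 'a option \<times> 'b option \<Rightarrow> ennreal" where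
  "star_ext \<psi> p = (case p of (Some a, Some b) \<Rightarrow> \<psi> (a, b) | _ \<Rightarrow> 0)"

definition star_inf :: "('a \<times> 'b \<Rightarrow> ennreal) \<Rightarrow> 'a spmf \<Rightarrow> 'b spmf \<Rightarrow> ennreal" where
  "star_inf \<psi> d1 d2 = (INF \<mu> \<in> star_couplings d1 d2. \<integral>\<^sup>+ p. star_ext \<psi> p \<partial>measure_pmf \<mu>)"

definition guarded :: "bool \<Rightarrow> ennreal \<Rightarrow> ennreal" (infixr "\<triangleright>" 60) where
  "P \<triangleright> a = (if P then a else \<infinity>)"

text \<open>
  The index sets \<open>Z\<close> of judgments vary within a derivation, so they are taken as subsets of one
  universe that is closed under the formation of \<open>Val \<times> Z\<close> (constructor \<open>LVal\<close>) and of
  \<open>\<P>(Mem) \<times> Z\<close> (constructor \<open>LSet\<close>), and contains all real-valued functions on memories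
  (\<open>LFun\<close>). The type parameter \<open>'u\<close> (\<open>LAtom\<close>) supplies index sets of arbitrary size; results are
  stated for all \<open>'u\<close>, hence for derivations using whatever index sets.
\<close>

datatype ('x, 'v, 'u) logvar =
    LFun (lfun: "('x, 'v) mem \<Rightarrow> real")
  | LAtom 'u
  | LVal (lval: 'v) (lrest: "('x, 'v, 'u) logvar")
  | LSet (lset: "('x, 'v) mem set") (lrest: "('x, 'v, 'u) logvar")

type_synonym ('x, 'v, 'u) assn = "('x, 'v, 'u) logvar \<Rightarrow> ('x, 'v) mem \<times> ('x, 'v) mem \<Rightarrow> ennreal"

text \<open>
  Assertions are total functions on the universe, but only their values on the index set matter:
  by rule \<open>Conseq\<close> they may be changed arbitrarily outside of it.
\<close>

inductive erhl ::
  "('e \<Rightarrow> ('x, 'v) mem \<Rightarrow> 'v) \<Rightarrow> ('b \<Rightarrow> ('x, 'v) mem \<Rightarrow> bool) \<Rightarrow> ('s \<Rightarrow> ('x, 'v) mem \<Rightarrow> 'v pmf)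
    \<Rightarrow> ('x, 'v, 'u) logvar set \<Rightarrow> ('x, 'v, 'u) assn
    \<Rightarrow> ('x, 'e, 'b, 's) stmt \<Rightarrow> ('x, 'e, 'b, 's) stmt \<Rightarrow> ('x, 'v, 'u) assn \<Rightarrow> bool"
  for \<E> :: "'e \<Rightarrow> ('x, 'v) mem \<Rightarrow> 'v"
    and \<B> :: "'b \<Rightarrow> ('x, 'v) mem \<Rightarrow> bool"
    and \<S> :: "'s \<Rightarrow> ('x, 'v) mem \<Rightarrow> 'v pmf"
where
  Unit:
    "\<lbrakk>erhl \<E> \<B> \<S> Z \<Phi> C D \<Psi>; unit_nf C = unit_nf C'; unit_nf D = unit_nf D'\<rbrakk>
     \<Longrightarrow> erhl \<E> \<B> \<S> Z \<Phi> C' D' \<Psi>"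
| Skip:
    "Z \<noteq> {} \<Longrightarrow> erhl \<E> \<B> \<S> Z \<Phi> Skip Skip \<Phi>"
| Asgn:
    "Z \<noteq> {} \<Longrightarrow>
     erhl \<E> \<B> \<S> Z (\<lambda>z (m1, m2). \<Phi> z (m1(x := \<E> e m1), m2(y := \<E> e' m2)))
       (Assign x e) (Assign y e') \<Phi>"
| Sample:
    "\<lbrakk>Z \<noteq> {};
      \<And>m1 m2. \<mu> m1 m2 \<in> couplings (spmf_of_pmf (\<S> s m1)) (spmf_of_pmf (\<S> s' m2))\<rbrakk> \<Longrightarrow>
     erhl \<E> \<B> \<S> Z
       (\<lambda>z (m1, m2). \<integral>\<^sup>+ (v1, v2). \<Phi> z (m1(x := v1), m2(y := v2)) \<partial>measure_spmf (\<mu> m1 m2))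
       (Sample x s) (Sample y s') \<Phi>"
| If:
    "\<lbrakk>erhl \<E> \<B> \<S> Z (\<lambda>z (m1, m2). (\<B> b m1 \<and> \<B> b' m2) \<triangleright> \<Phi> z (m1, m2)) C1 D1 \<Psi>;
      erhl \<E> \<B> \<S> Z (\<lambda>z (m1, m2). (\<not> \<B> b m1 \<and> \<not> \<B> b' m2) \<triangleright> \<Phi> z (m1, m2)) C2 D2 \<Psi>\<rbrakk> \<Longrightarrow>
     erhl \<E> \<B> \<S> Z (\<lambda>z (m1, m2). (\<B> b m1 \<longleftrightarrow> \<B> b' m2) \<triangleright> \<Phi> z (m1, m2))
       (Cond b C1 C2) (Cond b' D1 D2) \<Psi>"
| While:
    "erhl \<E> \<B> \<S> Z (\<lambda>z (m1, m2). (\<B> b m1 \<and> \<B> b' m2) \<triangleright> \<Phi> z (m1, m2))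
       C D (\<lambda>z (m1, m2). (\<B> b m1 \<longleftrightarrow> \<B> b' m2) \<triangleright> \<Phi> z (m1, m2)) \<Longrightarrow>
     erhl \<E> \<B> \<S> Z (\<lambda>z (m1, m2). (\<B> b m1 \<longleftrightarrow> \<B> b' m2) \<triangleright> \<Phi> z (m1, m2))
       (While b C) (While b' D)
       (\<lambda>z (m1, m2). (\<not> \<B> b m1 \<and> \<not> \<B> b' m2) \<triangleright> \<Phi> z (m1, m2))"
| Seq:
    "\<lbrakk>erhl \<E> \<B> \<S> Z \<Phi> C1 D1 \<Theta>; erhl \<E> \<B> \<S> Z \<Theta> C2 D2 \<Psi>\<rbrakk> \<Longrightarrow>
     erhl \<E> \<B> \<S> Z \<Phi> (Seq C1 C2) (Seq D1 D2) \<Psi>"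
| Asgn_L:
    "Z \<noteq> {} \<Longrightarrow>
     erhl \<E> \<B> \<S> Z (\<lambda>z (m1, m2). \<Phi> z (m1(x := \<E> e m1), m2)) (Assign x e) Skip \<Phi>"
| Asgn_R:
    "Z \<noteq> {} \<Longrightarrow>
     erhl \<E> \<B> \<S> Z (\<lambda>z (m1, m2). \<Phi> z (m1, m2(x := \<E> e m2))) Skip (Assign x e) \<Phi>"
| Sample_L:
    "Z \<noteq> {} \<Longrightarrow>
     erhl \<E> \<B> \<S> Z (\<lambda>z (m1, m2). \<integral>\<^sup>+ v. \<Phi> z (m1(x := v), m2) \<partial>measure_pmf (\<S> s m1))
       (Sample x s) Skip \<Phi>"
| Sample_R:
    "Z \<noteq> {} \<Longrightarrow>
     erhl \<E> \<B> \<S> Z (\<lambda>z (m1, m2). \<integral>\<^sup>+ v. \<Phi> z (m1, m2(x := v)) \<partial>measure_pmf (\<S> s m2))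
       Skip (Sample x s) \<Phi>"
| If_L:
    "\<lbrakk>erhl \<E> \<B> \<S> Z (\<lambda>z (m1, m2). \<B> b m1 \<triangleright> \<Phi> z (m1, m2)) C1 Skip \<Psi>;
      erhl \<E> \<B> \<S> Z (\<lambda>z (m1, m2). (\<not> \<B> b m1) \<triangleright> \<Phi> z (m1, m2)) C2 Skip \<Psi>\<rbrakk> \<Longrightarrow>
     erhl \<E> \<B> \<S> Z \<Phi> (Cond b C1 C2) Skip \<Psi>"
| If_R:
    "\<lbrakk>erhl \<E> \<B> \<S> Z (\<lambda>z (m1, m2). \<B> b m2 \<triangleright> \<Phi> z (m1, m2)) Skip D1 \<Psi>;
      erhl \<E> \<B> \<S> Z (\<lambda>z (m1, m2). (\<not> \<B> b m2) \<triangleright> \<Phi> z (m1, m2)) Skip D2 \<Psi>\<rbrakk> \<Longrightarrow>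
     erhl \<E> \<B> \<S> Z \<Phi> Skip (Cond b D1 D2) \<Psi>"
| While_L:
    "erhl \<E> \<B> \<S> Z (\<lambda>z (m1, m2). \<B> b m1 \<triangleright> \<Phi> z (m1, m2)) C Skip \<Phi> \<Longrightarrow>
     erhl \<E> \<B> \<S> Z \<Phi> (While b C) Skip (\<lambda>z (m1, m2). (\<not> \<B> b m1) \<triangleright> \<Phi> z (m1, m2))"
| While_R:
    "erhl \<E> \<B> \<S> Z (\<lambda>z (m1, m2). \<B> b m2 \<triangleright> \<Phi> z (m1, m2)) Skip D \<Phi> \<Longrightarrow>
     erhl \<E> \<B> \<S> Z \<Phi> Skip (While b D) (\<lambda>z (m1, m2). (\<not> \<B> b m2) \<triangleright> \<Phi> z (m1, m2))"
| Conseq: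
    "\<lbrakk>erhl \<E> \<B> \<S> Z' \<Phi>' C D \<Psi>'; Z \<noteq> {};
      \<And>m1 m2 (d1 :: ('x, 'v) mem spmf) (d2 :: ('x, 'v) mem spmf).
        \<forall>z' \<in> Z'. \<Phi>' z' (m1, m2) \<ge> star_inf (\<Psi>' z') d1 d2 \<Longrightarrow>
        \<forall>z \<in> Z. \<Phi> z (m1, m2) \<ge> star_inf (\<Psi> z) d1 d2\<rbrakk> \<Longrightarrow>
     erhl \<E> \<B> \<S> Z \<Phi> C D \<Psi>"
| Nmod_L:
    "\<lbrakk>not_modified \<E> \<B> \<S> x C;
      erhl \<E> \<B> \<S> {LVal v z | v z. z \<in> Z}
        (\<lambda>w (m1, m2). (m1 x = lval w) \<triangleright> \<Phi> (lrest w) (m1, m2))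
        C D
        (\<lambda>w (m1, m2). \<Psi> (lrest w) (m1(x := lval w), m2))\<rbrakk> \<Longrightarrow>
     erhl \<E> \<B> \<S> Z \<Phi> C D \<Psi>"
| Nmod_R:
    "\<lbrakk>not_modified \<E> \<B> \<S> x D;
      erhl \<E> \<B> \<S> {LVal v z | v z. z \<in> Z}
        (\<lambda>w (m1, m2). (m2 x = lval w) \<triangleright> \<Phi> (lrest w) (m1, m2))
        C D
        (\<lambda>w (m1, m2). \<Psi> (lrest w) (m1, m2(x := lval w)))\<rbrakk> \<Longrightarrow>
     erhl \<E> \<B> \<S> Z \<Phi> C D \<Psi>"
| Strassen_to_sets:
    "\<lbrakk>ast \<E> \<B> \<S> C; ast \<E> \<B> \<S> D;
      erhl \<E> \<B> \<S> Z \<Phi> C D (\<lambda>z (m1, m2). of_bool ((m1, m2) \<notin> R z))\<rbrakk> \<Longrightarrow>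
     erhl \<E> \<B> \<S> {LSet M z | M z. z \<in> Z}
       (\<lambda>w (m1, m2). 1 + \<Phi> (lrest w) (m1, m2))
       C D
       (\<lambda>w (m1, m2). of_bool (m1 \<in> lset w) + of_bool (m2 \<notin> R (lrest w) `` lset w))"
| Strassen_from_sets:
    "\<lbrakk>ast \<E> \<B> \<S> C; ast \<E> \<B> \<S> D;
      erhl \<E> \<B> \<S> {LSet M z | M z. z \<in> Z}
        (\<lambda>w (m1, m2). 1 + \<Phi> (lrest w) (m1, m2))
        C D
        (\<lambda>w (m1, m2). of_bool (m1 \<in> lset w) + of_bool (m2 \<notin> R (lrest w) `` lset w))\<rbrakk> \<Longrightarrow>
     erhl \<E> \<B> \<S> Z \<Phi> C D (\<lambda>z (m1, m2). of_bool ((m1, m2) \<notin> R z))"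

definition kantorovich :: "('a \<Rightarrow> 'a \<Rightarrow> real) \<Rightarrow> 'a spmf \<Rightarrow> 'a spmf \<Rightarrow> ennreal" where
  "kantorovich \<delta> d1 d2 =
     (INF \<mu> \<in> couplings d1 d2. \<integral>\<^sup>+ (a1, a2). ennreal (\<delta> a1 a2) \<partial>measure_spmf \<mu>)"

definition lipschitz1 :: "('a \<Rightarrow> 'a \<Rightarrow> real) \<Rightarrow> ('a \<Rightarrow> real) set" where
  "lipschitz1 \<delta> = {f. \<forall>a1 a2. \<bar>f a1 - f a2\<bar> \<le> \<delta> a1 a2}"

end

theory Submission
  imports Defs "HOL-Library.Diagonal_Subsequence"
begin

text \<open>
  \<^bold>\<open>From derivability to the bound.\<close> Every rule preserves the semantic judgment ``the optimal
  \<open>\<star>\<close>-coupling cost of \<open>\<Psi>\<close> is at most \<open>\<Phi>\<close>''. Sets of couplings are compact, so optimal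
  couplings exist and costs are lower semicontinuous, which settles loops. An optimal coupling
  admits no cheaper rerouting along an alternating cycle of its support. For a \<open>0/1\<close> cost this gives
  Strassen's theorem: the points reachable from a bad pair by alternating paths form a set violating
  the marginal inequality by exactly the bad mass. For a metric, the cheapest alternating path from a
  base point is, up to sign, a \<open>1\<close>-Lipschitz function \<open>f\<close> with \<open>f a - f b = \<delta> a b\<close> on the support
  of the optimal coupling; the judgment at this \<open>f\<close> is the bound on the Kantorovich distance.

  \<^bold>\<open>From the bound to derivability.\<close> The one-sided rules derive weakest preconditions, so
  \<open>C; skip \<sim> skip; D\<close> gives the precondition under the independent coupling. The expectation
  of \<open>f(m\<^sub>1) - f(m\<^sub>2) + h\<close> is the same under all couplings, hence at most \<open>\<Phi> + h\<close>.
\<close>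

subsection \<open>Compactness of couplings\<close>

text \<open>Diagonal argument: \<open>[0,1]\<close> is sequentially compact, so each point of an
  enumeration of \<open>S\<close> can be made convergent by refining the subsequence. The later use
  takes for \<open>S\<close> the union of the supports of a sequence of couplings, which is
  countable over any type.\<close>

lemma pointwise_convergent_subsequence:
  fixes f :: "nat \<Rightarrow> 'a \<Rightarrow> real"
  assumes S: "countable S" and out: "\<And>i x. x \<notin> S \<Longrightarrow> f i x = 0" and bnd: "\<And>i x. f i x \<in> {0..1}"
  obtains r l where "strict_mono (r :: nat \<Rightarrow> nat)" "\<And>x. (\<lambda>i. f (r i) x) \<longlonglongrightarrow> l x"
proof -
  define g where "g n i = f i (from_nat_into S n)" for n i
  interpret subseqs "\<lambda>n s. convergent (\<lambda>i. g n (s i))"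
  proof
    fix n :: nat and s :: "nat \<Rightarrow> nat"
    have "seq_compact {0..1::real}"
      by (simp add: compact_eq_seq_compact_metric[symmetric])
    moreover have "\<forall>i. g n (s i) \<in> {0..1}" using bnd unfolding g_def by blast
    ultimately obtain l r where "strict_mono r" "((\<lambda>i. g n (s i)) \<circ> r) \<longlonglongrightarrow> l"
      unfolding seq_compact_def by meson
    thus "\<exists>r'. strict_mono r' \<and> convergent (\<lambda>i. g n ((s \<circ> r') i))"
      by (auto simp: o_def convergent_def)
  qed
  have conv: "convergent (\<lambda>i. g n (diagseq i))" for n
  proof -
    have "convergent (\<lambda>i. g n ((diagseq \<circ> (+) (Suc n)) i))"
    proof (rule diagseq_holds)
      fix r s n assume "strict_mono (r :: nat \<Rightarrow> nat)" "convergent (\<lambda>i. g n (s i))"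
      thus "convergent (\<lambda>i. g n ((s \<circ> r) i))"
        unfolding o_def using convergent_subseq_convergent[of "\<lambda>i. g n (s i)" r] by (simp add: o_def)
    qed
    hence "convergent (\<lambda>i. g n (diagseq (i + Suc n)))" by (simp add: o_def add.commute)
    thus ?thesis by (rule convergent_ignore_initial_segment[THEN iffD1])
  qed
  have "convergent (\<lambda>i. f (diagseq i) x)" for x
  proof (cases "x \<in> S")
    case True
    thus ?thesis using conv[of "to_nat_on S x"] S by (simp add: g_def)
  qed (simp add: out convergent_const)
  hence "\<And>x. (\<lambda>i. f (diagseq i) x) \<longlonglongrightarrow> lim (\<lambda>i. f (diagseq i) x)"
    by (simp add: convergent_LIMSEQ_iff)
  thus thesis by (rule that[OF subseq_diagseq])
qed

text \<open>Both total masses are 1, so a strict gap at one point would have to be made up on its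
  complement, where \<open>p\<close> is below \<open>q\<close> as well. This upgrades the one-sided
  bounds that Fatou's lemma yields.\<close>

lemma pmf_eq_if_le:
  assumes "\<And>x. pmf p x \<le> pmf q x"
  shows "p = q"
proof (rule pmf_eqI, rule ccontr)
  fix x assume "pmf p x \<noteq> pmf q x"
  hence less: "pmf p x < pmf q x" using assms[of x] by simp
  have "measure_pmf.prob p (- {x}) \<le> measure_pmf.prob q (- {x})"
  proof -
    have "emeasure p (- {x}) \<le> emeasure q (- {x})"
      unfolding nn_integral_pmf[symmetric] by (intro nn_integral_mono) (simp add: assms)
    thus ?thesis by (simp add: measure_pmf.emeasure_eq_measure)
  qed
  moreover have "measure_pmf.prob r (- {x}) = 1 - pmf r x" for r
    using measure_pmf.prob_compl[of "{x}" r] by (simp add: Compl_eq_Diff_UNIV measure_pmf_single)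
  ultimately show False using less by simp
qed

lemma pmf_finite_approx:
  assumes "e > 0"
  obtains F where "finite F" "measure_pmf.prob p F > 1 - e"
proof (cases "e < 1")
  case True
  have "ennreal (1 - e) < (SUP F\<in>{F. finite F \<and> F \<subseteq> UNIV}. ennreal (sum (pmf p) F))"
    using infsetsum_nonneg_is_SUPREMUM_ennreal[of "pmf p" UNIV, symmetric] assms True
      measure_pmf_conv_infsetsum[of p UNIV]
    by (simp add: ennreal_less_iff pmf_abs_summable)
  then obtain F where "finite F" "ennreal (1 - e) < ennreal (sum (pmf p) F)"
    by (auto simp: less_SUP_iff)
  thus thesis using that[of F] True by (simp add: ennreal_less_iff measure_measure_pmf_finite)
\<comment> \<open>Here \<open>1 - e\<close> is at most 0, and a single point of positive mass gives
  the strict inequality.\<close>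
next
  case False
  have "measure_pmf.prob p {SOME x. x \<in> set_pmf p} > 0"
    by (simp add: measure_pmf_single pmf_positive some_in_eq set_pmf_not_empty)
  thus thesis using that[of "{SOME x. x \<in> set_pmf p}"] False by simp
qed

text \<open>
  Mass cannot escape to infinity along the sequence, since the marginals converge and are thus tight.
\<close>

lemma coupling_compactness:
  fixes \<mu> :: "nat \<Rightarrow> ('a \<times> 'b) pmf" and \<psi> :: "'a \<times> 'b \<Rightarrow> ennreal"
  assumes m1: "\<And>i. map_pmf fst (\<mu> i) = p i" and m2: "\<And>i. map_pmf snd (\<mu> i) = q i"
    and cp: "\<And>x. (\<lambda>i. pmf (p i) x) \<longlonglongrightarrow> pmf p' x"
    and cq: "\<And>x. (\<lambda>i. pmf (q i) x) \<longlonglongrightarrow> pmf q' x"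
    and cost: "\<And>i. (\<integral>\<^sup>+x. \<psi> x \<partial>measure_pmf (\<mu> i)) \<le> c i" and c: "c \<longlonglongrightarrow> c'"
  shows "\<exists>\<nu>. map_pmf fst \<nu> = p' \<and> map_pmf snd \<nu> = q' \<and> (\<integral>\<^sup>+x. \<psi> x \<partial>measure_pmf \<nu>) \<le> c'"
proof -
  obtain r g where r: "strict_mono (r :: nat \<Rightarrow> nat)" and g: "\<And>x. (\<lambda>i. pmf (\<mu> (r i)) x) \<longlonglongrightarrow> g x"
  proof (rule pointwise_convergent_subsequence[of "\<Union>i. set_pmf (\<mu> i)" "\<lambda>i. pmf (\<mu> i)"])
    show "pmf (\<mu> i) x = 0" if "x \<notin> (\<Union>i. set_pmf (\<mu> i))" for i x
      using that by (auto simp: set_pmf_eq)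
  qed (auto simp: pmf_le_1)
  have g0: "0 \<le> g x" for x
    by (rule LIMSEQ_le_const[OF g]) simp
  \<comment> \<open>Fatou's lemma for a general weight \<open>w\<close>: \<open>w = 1\<close> bounds
    the mass of the limit, indicators bound its marginals, and \<open>w = \<psi>\<close> bounds its
    cost.\<close>
  have fatou: "(\<integral>\<^sup>+x. ennreal (g x) * w x \<partial>count_space UNIV) \<le> liminf (\<lambda>i. \<integral>\<^sup>+x. w x \<partial>measure_pmf (\<mu> (r i)))"
    for w :: "'a \<times> 'b \<Rightarrow> ennreal"
  proof -
    have "(\<integral>\<^sup>+x. ennreal (g x) * w x \<partial>count_space UNIV)
       \<le> (\<integral>\<^sup>+x. liminf (\<lambda>i. ennreal (pmf (\<mu> (r i)) x) * w x) \<partial>count_space UNIV)"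
    proof (rule nn_integral_mono)
      fix x :: "'a \<times> 'b"
      \<comment> \<open>Multiplication need not be continuous at \<open>0 * \<infinity>\<close>, but
        there the left-hand side is 0 and nothing has to be shown.\<close>
      have "ennreal (g x) = 0 \<or> (\<lambda>i. ennreal (pmf (\<mu> (r i)) x) * w x) \<longlonglongrightarrow> ennreal (g x) * w x"
        using g[of x] by (cases "ennreal (g x) = 0") (auto intro!: tendsto_mult_ennreal tendsto_ennrealI)
      thus "ennreal (g x) * w x \<le> liminf (\<lambda>i. ennreal (pmf (\<mu> (r i)) x) * w x)"
        by (auto dest: lim_imp_Liminf[OF sequentially_bot])
    qed
    also have "\<dots> \<le> liminf (\<lambda>i. \<integral>\<^sup>+x. ennreal (pmf (\<mu> (r i)) x) * w x \<partial>count_space UNIV)"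
      by (rule nn_integral_liminf) simp
    finally show ?thesis by (simp add: nn_integral_measure_pmf)
  qed
  have le1: "(\<integral>\<^sup>+x. ennreal (g x) \<partial>count_space UNIV) \<le> 1"
    using fatou[of "\<lambda>_. 1"] by (simp add: Liminf_const)
  \<comment> \<open>Tightness: finite sets \<open>F\<close> and \<open>G\<close> carry almost all of
    the limiting marginals, so the finite rectangle \<open>F \<times> G\<close> keeps almost all
    mass of the couplings in the limit.\<close>
  have ge1: "1 \<le> (\<integral>\<^sup>+x. ennreal (g x) \<partial>count_space UNIV)"
  proof (rule ennreal_le_epsilon)
    fix e :: real assume e: "0 < e"
    obtain F where F: "finite F" "measure_pmf.prob p' F > 1 - e/2"
      using pmf_finite_approx[of "e/2" p'] e by auto
    obtain G where G: "finite G" "measure_pmf.prob q' G > 1 - e/2"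
      using pmf_finite_approx[of "e/2" q'] e by auto
    \<comment> \<open>Inclusion-exclusion, with the probability of the union bounded by 1.\<close>
    have "sum (pmf (p (r i))) F + sum (pmf (q (r i))) G - 1 \<le> sum (pmf (\<mu> (r i))) (F \<times> G)" for i
    proof -
      let ?m = "measure_pmf (\<mu> (r i))"
      have "sum (pmf (p (r i))) F = measure ?m (fst -` F)"
        using F by (simp add: m1[symmetric] measure_measure_pmf_finite[symmetric])
      moreover have "sum (pmf (q (r i))) G = measure ?m (snd -` G)"
        using G by (simp add: m2[symmetric] measure_measure_pmf_finite[symmetric])
      moreover have "sum (pmf (\<mu> (r i))) (F \<times> G) = measure ?m (fst -` F \<inter> snd -` G)"
        using F G by (subst measure_measure_pmf_finite[symmetric]) (auto intro!: arg_cong2[where f=measure])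
      moreover have "measure ?m (fst -` F \<union> snd -` G) + measure ?m (fst -` F \<inter> snd -` G)
         = measure ?m (fst -` F) + measure ?m (snd -` G)"
        using measure_pmf.finite_measure_Union'[of "fst -` F" "\<mu> (r i)" "snd -` G"]
          measure_pmf.finite_measure_Diff'[of "snd -` G" "\<mu> (r i)" "fst -` F"]
        by (simp add: Int_commute)
      moreover have "measure ?m (fst -` F \<union> snd -` G) \<le> 1" by simp
      ultimately show ?thesis by linarith
    qed
    moreover have "(\<lambda>i. sum (pmf (p (r i))) F + sum (pmf (q (r i))) G - 1) \<longlonglongrightarrow>
       sum (pmf p') F + sum (pmf q') G - 1"
      using LIMSEQ_subseq_LIMSEQ[OF cp r] LIMSEQ_subseq_LIMSEQ[OF cq r] 
      by (intro tendsto_intros) (auto simp: o_def)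
    moreover have "(\<lambda>i. sum (pmf (\<mu> (r i))) (F \<times> G)) \<longlonglongrightarrow> sum g (F \<times> G)"
      by (intro tendsto_intros g)
    ultimately have "sum (pmf p') F + sum (pmf q') G - 1 \<le> sum g (F \<times> G)"
      by (intro LIMSEQ_le) auto
    hence "1 \<le> sum g (F \<times> G) + e"
      using F G by (simp add: measure_measure_pmf_finite)
    hence "ennreal 1 \<le> ennreal (sum g (F \<times> G) + e)" by (rule ennreal_leI)
    also have "\<dots> = (\<Sum>x\<in>F \<times> G. ennreal (g x)) + ennreal e"
      using e by (simp add: g0 sum_nonneg)
    also have "(\<Sum>x\<in>F \<times> G. ennreal (g x)) = (\<integral>\<^sup>+x. ennreal (g x) \<partial>count_space (F \<times> G))"
      using F G by (simp add: nn_integral_count_space_finite)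
    also have "\<dots> \<le> (\<integral>\<^sup>+x. ennreal (g x) \<partial>count_space UNIV)"
      by (simp add: nn_integral_count_space_indicator nn_integral_mono indicator_def)
    finally show "1 \<le> (\<integral>\<^sup>+x. ennreal (g x) \<partial>count_space UNIV) + ennreal e" by simp
  qed
  define \<nu> where "\<nu> = embed_pmf g"
  have \<nu>: "pmf \<nu> x = g x" for x
    unfolding \<nu>_def using g0 le1 ge1 by (intro pmf_embed_pmf) auto
  have fatou': "(\<integral>\<^sup>+x. w x \<partial>measure_pmf \<nu>) \<le> liminf (\<lambda>i. \<integral>\<^sup>+x. w x \<partial>measure_pmf (\<mu> (r i)))" for w
    using fatou[of w] by (simp add: nn_integral_measure_pmf \<nu>)
  \<comment> \<open>Fatou gives only an upper bound on each marginal; equality follows because both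
    sides are probability distributions.\<close>
  have "map_pmf fst \<nu> = p'"
  proof (rule pmf_eq_if_le)
    fix x
    have "(\<lambda>i. ennreal (pmf (p (r i)) x)) \<longlonglongrightarrow> ennreal (pmf p' x)"
      using LIMSEQ_subseq_LIMSEQ[OF cp r] by (auto simp: o_def)
    hence "liminf (\<lambda>i. ennreal (pmf (p (r i)) x)) = ennreal (pmf p' x)"
      by (rule lim_imp_Liminf[OF sequentially_bot])
    hence "ennreal (pmf (map_pmf fst \<nu>) x) \<le> ennreal (pmf p' x)"
      using fatou'[of "indicator (fst -` {x})"]
      by (simp add: m1[symmetric] ennreal_pmf_map del: nn_integral_indicator)
    thus "pmf (map_pmf fst \<nu>) x \<le> pmf p' x" by simp
  qed
  moreover have "map_pmf snd \<nu> = q'"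
  proof (rule pmf_eq_if_le)
    fix x
    have "(\<lambda>i. ennreal (pmf (q (r i)) x)) \<longlonglongrightarrow> ennreal (pmf q' x)"
      using LIMSEQ_subseq_LIMSEQ[OF cq r] by (auto simp: o_def)
    hence "liminf (\<lambda>i. ennreal (pmf (q (r i)) x)) = ennreal (pmf q' x)"
      by (rule lim_imp_Liminf[OF sequentially_bot])
    hence "ennreal (pmf (map_pmf snd \<nu>) x) \<le> ennreal (pmf q' x)"
      using fatou'[of "indicator (snd -` {x})"]
      by (simp add: m2[symmetric] ennreal_pmf_map del: nn_integral_indicator)
    thus "pmf (map_pmf snd \<nu>) x \<le> pmf q' x" by simp
  qed
  moreover have "(\<integral>\<^sup>+x. \<psi> x \<partial>measure_pmf \<nu>) \<le> c'"
  proof -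
    have "(\<integral>\<^sup>+x. \<psi> x \<partial>measure_pmf \<nu>) \<le> liminf (\<lambda>i. c (r i))"
      using cost by (intro order.trans[OF fatou'] Liminf_mono) auto
    also have "\<dots> = c'"
      using LIMSEQ_subseq_LIMSEQ[OF c r] by (intro lim_imp_Liminf) (auto simp: o_def)
    finally show ?thesis .
  qed
  ultimately show ?thesis by blast
qed

text \<open>The direct method: a minimising sequence, which exists since the product coupling makes
  the set nonempty, has a limit coupling whose cost is at most the infimum. The marginals are
  constant along the sequence.\<close>

lemma optimal_coupling_exists:
  fixes p :: "'a pmf" and q :: "'b pmf"
  shows "\<exists>\<mu>. map_pmf fst \<mu> = p \<and> map_pmf snd \<mu> = q \<and>
    (\<forall>\<nu>. map_pmf fst \<nu> = p \<longrightarrow> map_pmf snd \<nu> = q \<longrightarrow>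
      (\<integral>\<^sup>+x. \<psi> x \<partial>measure_pmf \<mu>) \<le> (\<integral>\<^sup>+x. \<psi> x \<partial>measure_pmf \<nu>))"
proof -
  let ?C = "{\<mu>. map_pmf fst \<mu> = p \<and> map_pmf snd \<mu> = q}"
  let ?cost = "\<lambda>\<mu>. \<integral>\<^sup>+x. \<psi> x \<partial>measure_pmf \<mu>"
  have "pair_pmf p q \<in> ?C" by (simp add: map_fst_pair_pmf map_snd_pair_pmf)
  hence "?cost ` ?C \<noteq> {}" by blast
  then obtain f where f: "range f \<subseteq> ?cost ` ?C" "f \<longlonglongrightarrow> Inf (?cost ` ?C)"
    using Inf_as_limit[of "?cost ` ?C"] by auto
  have "\<forall>i. \<exists>\<mu>. \<mu> \<in> ?C \<and> f i = ?cost \<mu>"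
    using subsetD[OF f(1) rangeI] by (simp add: image_iff)
  from choice[OF this] obtain \<mu> where "\<And>i. \<mu> i \<in> ?C \<and> f i = ?cost (\<mu> i)" by blast
  hence "\<exists>\<nu>. map_pmf fst \<nu> = p \<and> map_pmf snd \<nu> = q \<and> ?cost \<nu> \<le> Inf (?cost ` ?C)"
    using f(2) by (intro coupling_compactness[where \<mu> = \<mu> and c = f and p = "\<lambda>_. p" and q = "\<lambda>_. q"]) simp_all
  then obtain \<nu> where \<nu>: "map_pmf fst \<nu> = p" "map_pmf snd \<nu> = q" "?cost \<nu> \<le> Inf (?cost ` ?C)"
    by blast
  moreover have "?cost \<nu> \<le> ?cost \<nu>'" if "map_pmf fst \<nu>' = p" "map_pmf snd \<nu>' = q" for \<nu>'
    using that by (intro order.trans[OF \<nu>(3) INF_lower]) simp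
  ultimately show ?thesis by blast
qed

subsection \<open>Optimal couplings and alternating paths\<close>

lemma map_pmf_of_multiset:
  assumes "M \<noteq> {#}"
  shows "map_pmf f (pmf_of_multiset M) = pmf_of_multiset (image_mset f M)"
proof (rule pmf_eqI)
  fix x
  have "pmf (map_pmf f (pmf_of_multiset M)) x = measure (pmf_of_multiset M) (f -` {x} \<inter> set_mset M)"
    using measure_Int_set_pmf[of "pmf_of_multiset M" "f -` {x}"] assms by (simp add: pmf_map)
  also have "\<dots> = (\<Sum>y\<in>f -` {x} \<inter> set_mset M. count M y / size M)"
    using assms by (simp add: measure_measure_pmf_finite)
  also have "\<dots> = count (image_mset f M) x / size M"
    by (simp add: count_image_mset sum_divide_distrib)
  finally show "pmf (map_pmf f (pmf_of_multiset M)) x = pmf (pmf_of_multiset (image_mset f M)) x"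
    using assms by simp
qed

lemma sum_mset_image_eq_sum_count:
  fixes g :: "'a \<Rightarrow> real"
  assumes "finite A" "set_mset M \<subseteq> A"
  shows "sum_mset (image_mset g M) = (\<Sum>x\<in>A. g x * real (count M x))"
  using assms(2)
proof (induction M)
  case (add a M)
  have "(\<Sum>x\<in>A. g x * real (count (add_mset a M) x)) =
      (\<Sum>x\<in>A. (if x = a then g a else 0) + g x * real (count M x))"
    by (intro sum.cong) (auto simp: algebra_simps)
  also have "\<dots> = g a + (\<Sum>x\<in>A. g x * real (count M x))"
    using add.prems assms(1) by (simp add: sum.distrib)
  finally show ?case using add by simp
qed simp

lemma nn_integral_pmf_of_multiset:
  fixes g :: "'a \<Rightarrow> real"
  assumes M: "M \<noteq> {#}" and g: "\<And>x. 0 \<le> g x"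
  shows "(\<integral>\<^sup>+x. ennreal (g x) \<partial>pmf_of_multiset M) = ennreal (sum_mset (image_mset g M) / size M)"
proof -
  have "(\<integral>\<^sup>+x. ennreal (g x) \<partial>pmf_of_multiset M) = (\<Sum>x\<in>set_mset M. ennreal (g x * (real (count M x) / real (size M))))"
    using M g by (subst nn_integral_measure_pmf_finite) (auto intro!: sum.cong simp: ennreal_mult''[symmetric])
  also have "\<dots> = ennreal (\<Sum>x\<in>set_mset M. g x * (real (count M x) / real (size M)))"
    using g by (intro sum_ennreal) auto
  also have "(\<Sum>x\<in>set_mset M. g x * (real (count M x) / real (size M))) = sum_mset (image_mset g M) / size M"
    by (simp add: sum_mset_image_eq_sum_count[of "set_mset M" M g] sum_divide_distrib)
  finally show ?thesis .
qed

text \<open>Cyclical monotonicity of the support. Moving a small mass \<open>\<epsilon>\<close> from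
  the uniform distribution on \<open>Q\<close> to the one on \<open>Z\<close> keeps both marginals,
  so it cannot lower the cost of an optimal coupling.\<close>

lemma optimal_coupling_rearrangement:
  fixes c :: "'a \<times> 'b \<Rightarrow> real"
  assumes c0: "\<And>x. 0 \<le> c x" and cK: "\<And>x. c x \<le> K"
    and opt: "\<And>\<nu>. map_pmf fst \<nu> = map_pmf fst \<mu> \<Longrightarrow> map_pmf snd \<nu> = map_pmf snd \<mu> \<Longrightarrow>
      (\<integral>\<^sup>+x. ennreal (c x) \<partial>measure_pmf \<mu>) \<le> (\<integral>\<^sup>+x. ennreal (c x) \<partial>measure_pmf \<nu>)"
    and Q: "set_mset Q \<subseteq> set_pmf \<mu>"
    and ZQ: "image_mset fst Z = image_mset fst Q" "image_mset snd Z = image_mset snd Q"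
  shows "sum_mset (image_mset c Q) \<le> sum_mset (image_mset c Z)"
proof (cases "Q = {#}")
  case False
  hence Z: "Z \<noteq> {#}" using ZQ by auto
  have sizes: "size Z = size Q" using ZQ by (metis size_image_mset)
  let ?p = "pmf_of_multiset Q" and ?q = "pmf_of_multiset Z"
  \<comment> \<open>Probabilities under \<open>?p\<close> are at most 1, so with this
    \<open>\<epsilon>\<close> the subtraction in \<open>g\<close> never goes below 0.\<close>
  define \<epsilon> where "\<epsilon> = Min (pmf \<mu> ` set_mset Q)"
  have eps: "\<epsilon> > 0"
    unfolding \<epsilon>_def using False Q by (subst Min_gr_iff) (auto simp: pmf_positive)
  define g where "g x = pmf \<mu> x - \<epsilon> * pmf ?p x + \<epsilon> * pmf ?q x" for x
  have g0: "0 \<le> g x" for x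
  proof -
    have "\<epsilon> * pmf ?p x \<le> pmf \<mu> x"
    proof (cases "x \<in># Q")
      case True
      hence "\<epsilon> \<le> pmf \<mu> x" unfolding \<epsilon>_def by simp
      moreover have "\<epsilon> * pmf ?p x \<le> \<epsilon> * 1" using eps pmf_le_1 by (intro mult_left_mono) auto
      ultimately show ?thesis by simp
    next
      case nin: False
      hence "pmf ?p x = 0" using False by (simp add: not_in_iff)
      thus ?thesis by simp
    qed
    moreover have "0 \<le> \<epsilon> * pmf ?q x" using eps by simp
    ultimately show ?thesis unfolding g_def by linarith
  qed
  \<comment> \<open>The perturbation is stated without subtraction, as \<open>ennreal\<close>
    demands. As with Fatou above, one weight \<open>w\<close> serves for total mass, marginals and
    cost.\<close>
  have key: "(\<integral>\<^sup>+x. ennreal (g x) * w x \<partial>count_space UNIV) + ennreal \<epsilon> * (\<integral>\<^sup>+x. w x \<partial>?p) =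
      (\<integral>\<^sup>+x. w x \<partial>\<mu>) + ennreal \<epsilon> * (\<integral>\<^sup>+x. w x \<partial>?q)" for w :: "'a \<times> 'b \<Rightarrow> ennreal"
  proof -
    have pt: "ennreal (g x) * w x + ennreal \<epsilon> * (ennreal (pmf ?p x) * w x) =
       ennreal (pmf \<mu> x) * w x + ennreal \<epsilon> * (ennreal (pmf ?q x) * w x)" for x
    proof -
      have "ennreal (g x) + ennreal \<epsilon> * ennreal (pmf ?p x) = ennreal (pmf \<mu> x) + ennreal \<epsilon> * ennreal (pmf ?q x)"
        using g0[of x] eps unfolding g_def
        by (simp add: ennreal_mult[symmetric] ennreal_plus[symmetric] del: ennreal_plus pmf_of_multiset)
      thus ?thesis by (metis distrib_right mult.assoc)
    qed
    show ?thesis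
      unfolding nn_integral_measure_pmf
      by (subst (1 2) nn_integral_cmult[symmetric], simp, simp, subst (1 2) nn_integral_add[symmetric]) (simp_all only: pt, simp_all)
  qed
  have "(\<integral>\<^sup>+x. ennreal (g x) \<partial>count_space UNIV) + ennreal \<epsilon> = 1 + ennreal \<epsilon>"
    using key[of "\<lambda>_. 1"] by simp
  hence one: "(\<integral>\<^sup>+x. ennreal (g x) \<partial>count_space UNIV) = 1"
    by (simp add: add.commute[of _ "ennreal \<epsilon>"] ennreal_add_left_cancel)
  define \<nu> where "\<nu> = embed_pmf g"
  have \<nu>: "pmf \<nu> x = g x" for x
    unfolding \<nu>_def using g0 one by (intro pmf_embed_pmf) auto
  have key': "(\<integral>\<^sup>+x. w x \<partial>\<nu>) + ennreal \<epsilon> * (\<integral>\<^sup>+x. w x \<partial>?p) =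
      (\<integral>\<^sup>+x. w x \<partial>\<mu>) + ennreal \<epsilon> * (\<integral>\<^sup>+x. w x \<partial>?q)" for w
    using key[of w] by (simp add: nn_integral_measure_pmf[of \<nu>] \<nu>)
  have marg: "map_pmf f \<nu> = map_pmf f \<mu>" if f: "map_pmf f ?p = map_pmf f ?q" for f :: "'a \<times> 'b \<Rightarrow> 'c"
  proof (rule pmf_eqI)
    fix x
    have "ennreal (pmf (map_pmf f \<nu>) x) + ennreal \<epsilon> * ennreal (pmf (map_pmf f ?p) x)
       = ennreal (pmf (map_pmf f \<mu>) x) + ennreal \<epsilon> * ennreal (pmf (map_pmf f ?p) x)"
      unfolding ennreal_pmf_map key' unfolding ennreal_pmf_map[symmetric] f ..
    thus "pmf (map_pmf f \<nu>) x = pmf (map_pmf f \<mu>) x"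
      by (simp add: ennreal_add_left_cancel add.commute[of _ "ennreal \<epsilon> * _"] ennreal_mult_eq_top_iff)
  qed
  have "map_pmf fst \<nu> = map_pmf fst \<mu>" "map_pmf snd \<nu> = map_pmf snd \<mu>"
    using False Z ZQ by (intro marg; simp add: map_pmf_of_multiset)+
  hence "(\<integral>\<^sup>+x. ennreal (c x) \<partial>\<mu>) \<le> (\<integral>\<^sup>+x. ennreal (c x) \<partial>\<nu>)" by (rule opt)
  hence "(\<integral>\<^sup>+x. ennreal (c x) \<partial>\<mu>) + ennreal \<epsilon> * (\<integral>\<^sup>+x. ennreal (c x) \<partial>?p) \<le>
      (\<integral>\<^sup>+x. ennreal (c x) \<partial>\<mu>) + ennreal \<epsilon> * (\<integral>\<^sup>+x. ennreal (c x) \<partial>?q)"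
    unfolding key'[symmetric] by (rule add_right_mono)
  \<comment> \<open>Bounded cost makes the integral finite, so it can be cancelled.\<close>
  moreover have "(\<integral>\<^sup>+x. ennreal (c x) \<partial>\<mu>) \<noteq> \<top>"
  proof -
    have "(\<integral>\<^sup>+x. ennreal (c x) \<partial>\<mu>) \<le> (\<integral>\<^sup>+x. ennreal K \<partial>\<mu>)"
      by (intro nn_integral_mono ennreal_leI cK)
    thus ?thesis by (auto simp: top_unique)
  qed
  ultimately have "ennreal \<epsilon> * (\<integral>\<^sup>+x. ennreal (c x) \<partial>?p) \<le> ennreal \<epsilon> * (\<integral>\<^sup>+x. ennreal (c x) \<partial>?q)"
    by (simp add: ennreal_add_left_cancel_le)
  hence "ennreal (sum_mset (image_mset c Q) / size Q) \<le> ennreal (sum_mset (image_mset c Z) / size Q)"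
    using eps c0
    by (simp add: ennreal_mult_le_mult_iff nn_integral_pmf_of_multiset[OF False] nn_integral_pmf_of_multiset[OF Z] sizes)
  moreover have "0 \<le> sum_mset (image_mset c Z)"
    using c0 by (subst sum_mset_image_eq_sum_count[of "set_mset Z"]) (auto intro!: sum_nonneg)
  moreover have "size Q > 0" using False by (simp add: nonempty_has_size[symmetric])
  ultimately show ?thesis using eps
    by (simp add: ennreal_le_iff divide_le_cancel)
qed (use ZQ in simp)

text \<open>
  Alternating paths: \<open>alternating S c a x r\<close> says that mass at \<open>a\<close> can be rerouted to \<open>x\<close>, replacing
  pairs of \<open>S\<close> by arbitrary pairs, at a change \<open>r\<close> of the total cost.
\<close>

inductive alternating :: "('a \<times> 'b) set \<Rightarrow> ('a \<times> 'b \<Rightarrow> real) \<Rightarrow> 'a \<Rightarrow> 'a \<Rightarrow> real \<Rightarrow> bool"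
  for S c a where
  alternating_refl: "alternating S c a a 0"
| alternating_step: "alternating S c a x r \<Longrightarrow> (x', y) \<in> S \<Longrightarrow> alternating S c a x' (r + c (x, y) - c (x', y))"

text \<open>\<open>Q\<close> collects the pairs removed along the path and \<open>Z\<close> the
  pairs inserted. Each step inserts \<open>(x, y)\<close> and removes \<open>(x', y)\<close>: second
  components balance, and first components balance up to the two ends of the path. Multisets are
  needed because a path may repeat a pair.\<close>

lemma alternating_multisets:
  assumes "alternating S c a x r"
  shows "\<exists>Q Z. set_mset Q \<subseteq> S \<and> add_mset a (image_mset fst Q) = add_mset x (image_mset fst Z) \<and>
    image_mset snd Q = image_mset snd Z \<and> r = sum_mset (image_mset c Z) - sum_mset (image_mset c Q)"
  using assms
proof induction
  case alternating_refl
  show ?case by (intro exI[of _ "{#}"]) simp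
next
  case (alternating_step x r x' y)
  then obtain Q Z where QZ: "set_mset Q \<subseteq> S" "add_mset a (image_mset fst Q) = add_mset x (image_mset fst Z)"
    "image_mset snd Q = image_mset snd Z" "r = sum_mset (image_mset c Z) - sum_mset (image_mset c Q)"
    by blast
  show ?case
    using QZ alternating_step.hyps
    by (intro exI[of _ "add_mset (x', y) Q"] exI[of _ "add_mset (x, y) Z"])
      (auto simp: add_mset_commute[of a])
qed

text \<open>Removing \<open>(a, b)\<close> and inserting \<open>(x, b)\<close> closes the path to a
  cycle with unchanged marginals, to which the rearrangement inequality applies.\<close>

lemma alternating_cycle_nonneg:
  assumes c0: "\<And>x. 0 \<le> c x" and cK: "\<And>x. c x \<le> K"
    and opt: "\<And>\<nu>. map_pmf fst \<nu> = map_pmf fst \<mu> \<Longrightarrow> map_pmf snd \<nu> = map_pmf snd \<mu> \<Longrightarrow>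
      (\<integral>\<^sup>+x. ennreal (c x) \<partial>measure_pmf \<mu>) \<le> (\<integral>\<^sup>+x. ennreal (c x) \<partial>measure_pmf \<nu>)"
    and alt: "alternating (set_pmf \<mu>) c a x r" and ab: "(a, b) \<in> set_pmf \<mu>"
  shows "c (a, b) \<le> r + c (x, b)"
proof -
  obtain Q Z where QZ: "set_mset Q \<subseteq> set_pmf \<mu>" "add_mset a (image_mset fst Q) = add_mset x (image_mset fst Z)"
    "image_mset snd Q = image_mset snd Z" "r = sum_mset (image_mset c Z) - sum_mset (image_mset c Q)"
    using alternating_multisets[OF alt] by blast
  have "sum_mset (image_mset c (add_mset (a, b) Q)) \<le> sum_mset (image_mset c (add_mset (x, b) Z))"
    using QZ ab by (intro optimal_coupling_rearrangement[OF c0 cK opt]) auto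
  thus ?thesis using QZ(4) by simp
qed

text \<open>Kantorovich-Rubinstein duality in the form of complementary slackness: one Lipschitz
  function is tight on the whole support of an optimal coupling, so integrating it against the
  marginals gives the optimal cost.\<close>

theorem kantorovich_potential:
  fixes \<delta> :: "'a \<Rightarrow> 'a \<Rightarrow> real"
  assumes "Metric_space UNIV \<delta>" and h: "\<And>x y. \<delta> x y \<le> h"
  obtains \<mu> f where "map_pmf fst \<mu> = p" "map_pmf snd \<mu> = q" "f \<in> lipschitz1 \<delta>"
    "\<And>a b. (a, b) \<in> set_pmf \<mu> \<Longrightarrow> f a - f b = \<delta> a b"
proof -
  interpret Metric_space UNIV \<delta> by fact
  have sym: "\<delta> x y = \<delta> y x" for x y by (rule commute)
  have tri: "\<delta> x z \<le> \<delta> x y + \<delta> y z" for x y z using triangle[of x y z] by simp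
  have refl: "\<delta> x x = 0" for x by simp
  let ?c = "\<lambda>x. \<delta> (fst x) (snd x)"
  obtain \<mu> where \<mu>: "map_pmf fst \<mu> = p" "map_pmf snd \<mu> = q"
    and opt: "\<And>\<nu>. map_pmf fst \<nu> = map_pmf fst \<mu> \<Longrightarrow> map_pmf snd \<nu> = map_pmf snd \<mu> \<Longrightarrow>
      (\<integral>\<^sup>+x. ennreal (?c x) \<partial>measure_pmf \<mu>) \<le> (\<integral>\<^sup>+x. ennreal (?c x) \<partial>measure_pmf \<nu>)"
    using optimal_coupling_exists[of p q "\<lambda>x. ennreal (?c x)"] by blast
  obtain a0 b0 where ab0: "(a0, b0) \<in> set_pmf \<mu>" using set_pmf_not_empty[of \<mu>] by auto
  let ?A = "alternating (set_pmf \<mu>) ?c a0"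
  \<comment> \<open>The costs of all ways to reroute mass from the base point \<open>a0\<close> and
    finally attach it to \<open>y\<close>. Their infimum is the potential up to sign.\<close>
  define T where "T y = {r + \<delta> x y | x r. ?A x r}" for y
  have T0: "T y \<noteq> {}" for y unfolding T_def using alternating_refl[of "set_pmf \<mu>" ?c a0] by auto
  \<comment> \<open>Closing the cycle at \<open>b0\<close> and using the triangle inequality bounds
    \<open>T y\<close> below, so the infimum is a genuine real number.\<close>
  have lower: "- \<delta> y b0 \<le> t" if t: "t \<in> T y" for t y
  proof -
    obtain x r where "t = r + \<delta> x y" "?A x r" using t unfolding T_def by blast
    moreover from this have "\<delta> a0 b0 \<le> r + \<delta> x b0"
      using alternating_cycle_nonneg[of ?c h \<mu> a0 x r b0] opt h ab0 by simp
    ultimately show ?thesis using tri[of x b0 y] nonneg[of a0 b0] by linarith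
  qed
  hence bdd: "bdd_below (T y)" for y by (intro bdd_belowI)
  define f where "f y = - Inf (T y)" for y
  have le: "- f y \<le> r + \<delta> x y" if "?A x r" for x y r
    unfolding f_def using that bdd by (auto intro!: cInf_lower simp: T_def)
  have ge: "m \<le> - f y" if "\<And>x r. ?A x r \<Longrightarrow> m \<le> r + \<delta> x y" for m y
    unfolding f_def using that T0 by (auto intro!: cInf_greatest simp: T_def)
  \<comment> \<open>Each path cost depends on \<open>y\<close> only through
    \<open>\<delta> x y\<close>, and an infimum of 1-Lipschitz functions is 1-Lipschitz.\<close>
  have lip: "f y - f z \<le> \<delta> y z" for y z
  proof -
    have "- f z - \<delta> y z \<le> - f y"
    proof (rule ge)
      fix x r assume "?A x r"
      thus "- f z - \<delta> y z \<le> r + \<delta> x y" using le[of x r z] tri[of x z y] by simp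
    qed
    thus ?thesis by simp
  qed
  have "\<bar>f y - f z\<bar> \<le> \<delta> y z" for y z using lip[of y z] lip[of z y] sym[of y z] by linarith
  moreover have "f a - f b = \<delta> a b" if ab: "(a, b) \<in> set_pmf \<mu>" for a b
  proof -
    \<comment> \<open>Every path from \<open>a0\<close> to \<open>x\<close> extends through the
      support pair \<open>(a, b)\<close> to \<open>a\<close>, where attaching \<open>a\<close> to
      itself costs nothing. This is the inequality opposite to the Lipschitz bound.\<close>
    have "- f a + \<delta> a b \<le> - f b"
    proof (rule ge)
      fix x r assume "?A x r"
      hence "?A a (r + \<delta> x b - \<delta> a b)" using alternating_step[OF _ ab, of ?c a0 x r] by simp
      thus "- f a + \<delta> a b \<le> r + \<delta> x b" using le[of a "r + \<delta> x b - \<delta> a b" a] refl by simp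
    qed
    thus ?thesis using lip[of a b] by simp
  qed
  ultimately show thesis using \<mu> by (intro that[of \<mu> f]) (auto simp: lipschitz1_def)
qed

theorem strassen_defect:
  fixes p :: "'a pmf" and q :: "'b pmf"
  assumes le: "\<And>M. emeasure p M \<le> emeasure q (R `` M) + \<phi>"
  shows "\<exists>\<mu>. map_pmf fst \<mu> = p \<and> map_pmf snd \<mu> = q \<and> emeasure \<mu> (- R) \<le> \<phi>"
proof -
  let ?c = "\<lambda>x. of_bool (x \<notin> R) :: real"
  obtain \<mu> where \<mu>: "map_pmf fst \<mu> = p" "map_pmf snd \<mu> = q"
    and opt: "\<And>\<nu>. map_pmf fst \<nu> = map_pmf fst \<mu> \<Longrightarrow> map_pmf snd \<nu> = map_pmf snd \<mu> \<Longrightarrow>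
      (\<integral>\<^sup>+x. ennreal (?c x) \<partial>measure_pmf \<mu>) \<le> (\<integral>\<^sup>+x. ennreal (?c x) \<partial>measure_pmf \<nu>)"
    using optimal_coupling_exists[of p q "\<lambda>x. ennreal (?c x)"] by blast
  let ?S = "set_pmf \<mu>"
  \<comment> \<open>The first components reachable from a bad pair without a net increase in
    cost.\<close>
  define M where "M = {x. \<exists>a b r. (a, b) \<in> ?S - R \<and> alternating ?S ?c a x r \<and> r \<le> 0}"
  have closed: "x' \<in> M" if "x \<in> M" "(x, y) \<in> R" "(x', y) \<in> ?S" for x x' y
  proof -
    obtain a b r where abr: "(a, b) \<in> ?S - R" "alternating ?S ?c a x r" "r \<le> 0"
      using \<open>x \<in> M\<close> unfolding M_def by blast
    hence "alternating ?S ?c a x' (r + ?c (x, y) - ?c (x', y))" using that by (intro alternating_step)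
    moreover have "r + ?c (x, y) - ?c (x', y) \<le> 0" using abr that by simp
    ultimately show ?thesis using abr(1) unfolding M_def by blast
  qed
  \<comment> \<open>Removing a second bad pair would save 1. Closing the cycle costs at most 1, so
    the bad pair \<open>(a, b)\<close> would be removed at no net cost, contradicting
    optimality.\<close>
  have good: "(x', y) \<in> R" if "x \<in> M" "(x, y) \<in> R" "(x', y) \<in> ?S" for x x' y
  proof (rule ccontr)
    assume bad: "(x', y) \<notin> R"
    obtain a b r where abr: "(a, b) \<in> ?S - R" "alternating ?S ?c a x r" "r \<le> 0"
      using \<open>x \<in> M\<close> unfolding M_def by blast
    have "alternating ?S ?c a x' (r + ?c (x, y) - ?c (x', y))" using that abr by (intro alternating_step)
    hence "?c (a, b) \<le> (r + ?c (x, y) - ?c (x', y)) + ?c (x', b)"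
      using abr(1) opt by (intro alternating_cycle_nonneg[where K = 1 and \<mu> = \<mu>]) auto
    thus False using abr bad that by (simp split: if_splits add: of_bool_def)
  qed
  have start: "a \<in> M" if "(a, b) \<in> ?S - R" for a b
    using that alternating_refl[of ?S ?c a] unfolding M_def by blast
  let ?N = "R `` M"
  have "emeasure p M = emeasure \<mu> (fst -` M \<inter> ?S)"
    using \<mu>(1) by (simp add: emeasure_Int_set_pmf flip: emeasure_map_pmf)
  \<comment> \<open>\<open>closed\<close> and \<open>start\<close> give the inclusion from right to
    left. \<open>good\<close> makes the two parts disjoint, as the next step uses.\<close>
  also have "fst -` M \<inter> ?S = (snd -` ?N \<inter> ?S) \<union> (- R \<inter> ?S)"
  proof (intro equalityI subrelI)
    fix x y assume "(x, y) \<in> fst -` M \<inter> ?S"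
    thus "(x, y) \<in> (snd -` ?N \<inter> ?S) \<union> (- R \<inter> ?S)" by auto
  next
    fix x y assume "(x, y) \<in> (snd -` ?N \<inter> ?S) \<union> (- R \<inter> ?S)"
    thus "(x, y) \<in> fst -` M \<inter> ?S" using closed[of _ y x] start[of x y] by auto
  qed
  also have "emeasure \<mu> \<dots> = emeasure \<mu> (snd -` ?N \<inter> ?S) + emeasure \<mu> (- R \<inter> ?S)"
    using good by (intro plus_emeasure[symmetric]) auto
  also have "\<dots> = emeasure q ?N + emeasure \<mu> (- R)"
    using \<mu>(2) by (simp add: emeasure_Int_set_pmf flip: emeasure_map_pmf)
  finally have "emeasure q ?N + emeasure \<mu> (- R) \<le> emeasure q ?N + \<phi>" using le[of M] by simp
  hence "emeasure \<mu> (- R) \<le> \<phi>" by (simp add: ennreal_add_left_cancel_le)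
  thus ?thesis using \<mu> by blast
qed

subsection \<open>Optimal cost of star-couplings\<close>

text \<open>The infimum is attained, so a bound on it can be exchanged for an explicit coupling with
  no loss of an epsilon.\<close>

lemma star_inf_le_iff:
  "star_inf \<psi> d1 d2 \<le> c \<longleftrightarrow> (\<exists>\<mu>\<in>star_couplings d1 d2. (\<integral>\<^sup>+p. star_ext \<psi> p \<partial>measure_pmf \<mu>) \<le> c)"
proof
  assume le: "star_inf \<psi> d1 d2 \<le> c"
  obtain \<mu> where \<mu>: "map_pmf fst \<mu> = d1" "map_pmf snd \<mu> = d2"
    and opt: "\<And>\<nu>. map_pmf fst \<nu> = d1 \<Longrightarrow> map_pmf snd \<nu> = d2 \<Longrightarrow>
      (\<integral>\<^sup>+x. star_ext \<psi> x \<partial>measure_pmf \<mu>) \<le> (\<integral>\<^sup>+x. star_ext \<psi> x \<partial>measure_pmf \<nu>)"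
    using optimal_coupling_exists[of d1 d2 "star_ext \<psi>"] by blast
  have "(\<integral>\<^sup>+x. star_ext \<psi> x \<partial>measure_pmf \<mu>) \<le> star_inf \<psi> d1 d2"
    unfolding star_inf_def by (rule INF_greatest) (auto simp: star_couplings_def intro: opt)
  with le have "(\<integral>\<^sup>+x. star_ext \<psi> x \<partial>measure_pmf \<mu>) \<le> c" by simp
  thus "\<exists>\<mu>\<in>star_couplings d1 d2. (\<integral>\<^sup>+p. star_ext \<psi> p \<partial>measure_pmf \<mu>) \<le> c"
    using \<mu> by (auto simp: star_couplings_def)
next
  assume "\<exists>\<mu>\<in>star_couplings d1 d2. (\<integral>\<^sup>+p. star_ext \<psi> p \<partial>measure_pmf \<mu>) \<le> c"
  thus "star_inf \<psi> d1 d2 \<le> c" unfolding star_inf_def by (auto intro: INF_lower2)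
qed

lemma star_ext_simps [simp]:
  "star_ext \<psi> (Some a, Some b) = \<psi> (a, b)"
  "star_ext \<psi> (None, y) = 0"
  "star_ext \<psi> (x, None) = 0"
  by (auto simp: star_ext_def split: option.splits)

lemma star_ext_mono: "(\<And>a b. \<psi> (a, b) \<le> \<psi>' (a, b)) \<Longrightarrow> star_ext \<psi> x \<le> star_ext \<psi>' x"
  by (auto simp: star_ext_def split: option.splits prod.splits)

lemma star_inf_mono:
  assumes "\<And>a b. \<psi> (a, b) \<le> \<psi>' (a, b)"
  shows "star_inf \<psi> d1 d2 \<le> star_inf \<psi>' d1 d2"
  unfolding star_inf_def using assms by (intro INF_mono' nn_integral_mono star_ext_mono)

lemma star_inf_cong:
  assumes "\<And>a b. a \<in> set_spmf d1 \<Longrightarrow> b \<in> set_spmf d2 \<Longrightarrow> \<psi> (a, b) = \<psi>' (a, b)"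
  shows "star_inf \<psi> d1 d2 = star_inf \<psi>' d1 d2"
  unfolding star_inf_def
proof (intro INF_cong refl nn_integral_cong_AE AE_pmfI)
  fix \<mu> x assume \<mu>: "\<mu> \<in> star_couplings d1 d2" and x: "x \<in> set_pmf \<mu>"
  have "fst x \<in> set_pmf (map_pmf fst \<mu>)" "snd x \<in> set_pmf (map_pmf snd \<mu>)" using x by auto
  with \<mu> have "fst x \<in> set_pmf d1" "snd x \<in> set_pmf d2" by (simp_all add: star_couplings_def)
  thus "star_ext \<psi> x = star_ext \<psi>' x"
    using assms by (auto simp: star_ext_def in_set_spmf split: option.splits prod.splits)
qed

lemma star_inf_swap_le: "star_inf (\<lambda>(b, a). \<psi> (a, b)) d2 d1 \<le> star_inf \<psi> d1 d2"
proof -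
  obtain \<mu> where \<mu>: "\<mu> \<in> star_couplings d1 d2" and le: "(\<integral>\<^sup>+p. star_ext \<psi> p \<partial>measure_pmf \<mu>) \<le> star_inf \<psi> d1 d2"
    using star_inf_le_iff[of \<psi> d1 d2 "star_inf \<psi> d1 d2"] by auto
  have "map_pmf prod.swap \<mu> \<in> star_couplings d2 d1"
    using \<mu> by (auto simp: star_couplings_def pmf.map_comp o_def)
  moreover have swap: "star_ext (\<lambda>(b, a). \<psi> (a, b)) (prod.swap p) = star_ext \<psi> p" for p
    by (cases p) (auto simp: star_ext_def split: option.splits)
  have "(\<integral>\<^sup>+p. star_ext (\<lambda>(b, a). \<psi> (a, b)) p \<partial>measure_pmf (map_pmf prod.swap \<mu>)) \<le> star_inf \<psi> d1 d2"
    unfolding nn_integral_map_pmf swap by (rule le)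
  ultimately show ?thesis unfolding star_inf_le_iff by blast
qed

lemma star_inf_swap: "star_inf \<psi> d1 d2 = star_inf (\<lambda>(b, a). \<psi> (a, b)) d2 d1"
  using star_inf_swap_le[of \<psi> d2 d1] star_inf_swap_le[of "\<lambda>(b, a). \<psi> (a, b)" d1 d2]
  by (intro antisym) auto

lemma star_inf_None_left [simp]: "star_inf \<psi> (return_pmf None) d = 0"
proof -
  have "star_inf \<psi> (return_pmf None) d \<le> 0"
    unfolding star_inf_le_iff
    by (intro bexI[of _ "map_pmf (Pair None) d"])
      (simp_all add: star_couplings_def pmf.map_comp o_def)
  thus ?thesis by simp
qed

text \<open>A coupling becomes a star-coupling by pairing the missing mass of one side with that of
  the other; the pair of two stars costs nothing.\<close>

lemma star_inf_le_coupling: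
  assumes "\<mu> \<in> couplings d1 d2"
  shows "star_inf \<psi> d1 d2 \<le> (\<integral>\<^sup>+x. \<psi> x \<partial>measure_spmf \<mu>)"
  unfolding star_inf_le_iff
proof
  let ?f = "\<lambda>x. (map_option fst x, map_option snd x)"
  show "map_pmf ?f \<mu> \<in> star_couplings d1 d2"
    using assms by (auto simp: star_couplings_def couplings_def pmf.map_comp o_def)
  have "(\<integral>\<^sup>+p. star_ext \<psi> p \<partial>measure_pmf (map_pmf ?f \<mu>)) =
      (\<integral>\<^sup>+x. (case x of None \<Rightarrow> 0 | Some y \<Rightarrow> \<psi> y) \<partial>measure_pmf \<mu>)"
    by (auto intro!: nn_integral_cong split: option.split)
  also have "\<dots> = (\<integral>\<^sup>+x. \<psi> x \<partial>measure_spmf \<mu>)"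
    unfolding measure_spmf_def
    by (subst nn_integral_distr) (auto simp: nn_integral_restrict_space intro!: nn_integral_cong split: option.split split_indicator)
  finally show "(\<integral>\<^sup>+p. star_ext \<psi> p \<partial>measure_pmf (map_pmf ?f \<mu>)) \<le> (\<integral>\<^sup>+x. \<psi> x \<partial>measure_spmf \<mu>)" by simp
qed

lemma star_inf_return: "star_inf \<psi> (return_spmf a) (return_spmf b) \<le> \<psi> (a, b)"
  using star_inf_le_coupling[of "return_spmf (a, b)" "return_spmf a" "return_spmf b" \<psi>]
  by (simp add: couplings_def measure_spmf_return_spmf nn_integral_return)

text \<open>Couplings compose: run an optimal coupling of the first stage, then for each resulting
  pair an optimal coupling of the continuations.\<close>

lemma star_inf_bind:
  "star_inf \<psi> (bind_spmf d1 f) (bind_spmf d2 g) \<le> star_inf (\<lambda>(a, b). star_inf \<psi> (f a) (g b)) d1 d2"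
proof -
  let ?\<theta> = "\<lambda>(a, b). star_inf \<psi> (f a) (g b)"
  obtain \<mu> where \<mu>: "map_pmf fst \<mu> = d1" "map_pmf snd \<mu> = d2"
    and le: "(\<integral>\<^sup>+p. star_ext ?\<theta> p \<partial>measure_pmf \<mu>) \<le> star_inf ?\<theta> d1 d2"
    using star_inf_le_iff[of ?\<theta> d1 d2 "star_inf ?\<theta> d1 d2"] by (auto simp: star_couplings_def)
  have "\<exists>\<nu>. map_pmf fst \<nu> = f a \<and> map_pmf snd \<nu> = g b \<and>
    (\<integral>\<^sup>+p. star_ext \<psi> p \<partial>measure_pmf \<nu>) \<le> star_inf \<psi> (f a) (g b)" for a b
    using star_inf_le_iff[of \<psi> "f a" "g b" "star_inf \<psi> (f a) (g b)"] by (auto simp: star_couplings_def)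
  then obtain \<nu> where \<nu>: "\<And>a b. map_pmf fst (\<nu> a b) = f a" "\<And>a b. map_pmf snd (\<nu> a b) = g b"
    "\<And>a b. (\<integral>\<^sup>+p. star_ext \<psi> p \<partial>measure_pmf (\<nu> a b)) \<le> star_inf \<psi> (f a) (g b)"
    by metis
  define F where "F = case_option (return_pmf None) f"
  define G where "G = case_option (return_pmf None) g"
  \<comment> \<open>If one side has already failed, its continuation stays at \<open>None\<close>,
    so every outcome costs 0 and the product coupling is good enough.\<close>
  define k where "k p = (case p of (Some a, Some b) \<Rightarrow> \<nu> a b | (x, y) \<Rightarrow> pair_pmf (F x) (G y))" for p
  have k: "map_pmf fst (k p) = F (fst p)" "map_pmf snd (k p) = G (snd p)" for p
    by (auto simp: k_def F_def G_def \<nu> map_fst_pair_pmf map_snd_pair_pmf split: option.split prod.split)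
  have "bind_pmf \<mu> k \<in> star_couplings (bind_spmf d1 f) (bind_spmf d2 g)"
    unfolding star_couplings_def
    by (auto simp: map_bind_pmf k bind_spmf_def F_def[symmetric] G_def[symmetric] bind_map_pmf \<mu>[symmetric])
  moreover have "(\<integral>\<^sup>+p. star_ext \<psi> p \<partial>measure_pmf (bind_pmf \<mu> k)) \<le> star_inf ?\<theta> d1 d2"
  proof -
    have "(\<integral>\<^sup>+p. star_ext \<psi> p \<partial>measure_pmf (k x)) \<le> star_ext ?\<theta> x" for x
      by (cases x; cases "fst x"; cases "snd x")
        (auto simp: k_def \<nu> F_def G_def pair_return_pmf1 pair_return_pmf2)
    hence "(\<integral>\<^sup>+p. star_ext \<psi> p \<partial>measure_pmf (bind_pmf \<mu> k)) \<le> (\<integral>\<^sup>+p. star_ext ?\<theta> p \<partial>measure_pmf \<mu>)"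
      by (simp add: nn_integral_mono)
    with le show ?thesis by simp
  qed
  ultimately show ?thesis unfolding star_inf_le_iff by blast
qed

text \<open>For full distributions the star has mass 0 in both marginals, so stripping
  \<open>Some\<close> with \<open>the\<close> is harmless almost surely.\<close>

lemma star_inf_spmf_of_pmf_le_iff:
  "star_inf \<psi> (spmf_of_pmf p) (spmf_of_pmf q) \<le> c \<longleftrightarrow>
    (\<exists>\<mu>. map_pmf fst \<mu> = p \<and> map_pmf snd \<mu> = q \<and> (\<integral>\<^sup>+x. \<psi> x \<partial>measure_pmf \<mu>) \<le> c)"
proof
  assume "star_inf \<psi> (spmf_of_pmf p) (spmf_of_pmf q) \<le> c"
  then obtain \<mu> where \<mu>: "map_pmf fst \<mu> = map_pmf Some p" "map_pmf snd \<mu> = map_pmf Some q"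
    and le: "(\<integral>\<^sup>+p. star_ext \<psi> p \<partial>measure_pmf \<mu>) \<le> c"
    unfolding star_inf_le_iff by (auto simp: star_couplings_def spmf_of_pmf_def)
  let ?\<nu> = "map_pmf (map_prod the the) \<mu>"
  have "map_pmf fst ?\<nu> = map_pmf the (map_pmf fst \<mu>)" "map_pmf snd ?\<nu> = map_pmf the (map_pmf snd \<mu>)"
    by (simp_all add: pmf.map_comp o_def)
  hence "map_pmf fst ?\<nu> = p" "map_pmf snd ?\<nu> = q"
    unfolding \<mu> by (simp_all add: pmf.map_comp o_def)
  moreover have "(\<integral>\<^sup>+x. \<psi> x \<partial>measure_pmf ?\<nu>) = (\<integral>\<^sup>+p. star_ext \<psi> p \<partial>measure_pmf \<mu>)"
    unfolding nn_integral_map_pmf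
  proof (intro nn_integral_cong_AE AE_pmfI)
    fix x assume "x \<in> set_pmf \<mu>"
    hence "fst x \<in> set_pmf (map_pmf Some p)" "snd x \<in> set_pmf (map_pmf Some q)"
      unfolding \<mu>[symmetric] by auto
    thus "\<psi> (map_prod the the x) = star_ext \<psi> x" by (cases x) auto
  qed
  ultimately show "\<exists>\<mu>. map_pmf fst \<mu> = p \<and> map_pmf snd \<mu> = q \<and> (\<integral>\<^sup>+x. \<psi> x \<partial>measure_pmf \<mu>) \<le> c"
    using le by (intro exI[of _ ?\<nu>]) simp
next
  assume "\<exists>\<mu>. map_pmf fst \<mu> = p \<and> map_pmf snd \<mu> = q \<and> (\<integral>\<^sup>+x. \<psi> x \<partial>measure_pmf \<mu>) \<le> c"
  then obtain \<mu> where \<mu>: "map_pmf fst \<mu> = p" "map_pmf snd \<mu> = q" "(\<integral>\<^sup>+x. \<psi> x \<partial>measure_pmf \<mu>) \<le> c" by blast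
  have "spmf_of_pmf \<mu> \<in> couplings (spmf_of_pmf p) (spmf_of_pmf q)"
    using \<mu> by (simp add: couplings_def)
  from star_inf_le_coupling[OF this, of \<psi>] \<mu>(3)
  show "star_inf \<psi> (spmf_of_pmf p) (spmf_of_pmf q) \<le> c" by simp
qed

section \<open>Suprema of increasing chains and the cost of loops\<close>

lemma ord_spmf_increasing:
  fixes d :: "nat \<Rightarrow> 'a spmf"
  assumes inc: "\<And>i. ord_spmf (=) (d i) (d (Suc i))"
  shows "i \<le> j \<Longrightarrow> ord_spmf (=) (d i) (d j)"
    and "Complete_Partial_Order.chain (ord_spmf (=)) (range d)"
proof -
  show le: "ord_spmf (=) (d i) (d j)" if "i \<le> j" for i j
    using that by (induction rule: dec_induct) (auto intro: inc ord_spmf_reflI spmf.leq_trans)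
  show "Complete_Partial_Order.chain (ord_spmf (=)) (range d)"
    by (auto simp: chain_def) (metis le linear)
qed

text \<open>The compactness lemma requires convergence at \<open>None\<close> too. The mass there
  decreases along the chain, and its limit comes from the total weights.\<close>

lemma pmf_lub_spmf_tendsto:
  fixes d :: "nat \<Rightarrow> 'a spmf"
  assumes inc: "\<And>i. ord_spmf (=) (d i) (d (Suc i))"
  shows "(\<lambda>i. pmf (d i) x) \<longlonglongrightarrow> pmf (lub_spmf (range d)) x"
proof -
  note chain = ord_spmf_increasing(2)[of d, OF inc]
  have meas: "(\<lambda>i. measure (measure_spmf (d i)) A) \<longlonglongrightarrow> measure (measure_spmf (lub_spmf (range d))) A" for A
  proof -
    have "measure (measure_spmf (lub_spmf (range d))) A = (SUP i. measure (measure_spmf (d i)) A)"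
      using measure_lub_spmf[OF chain, of A] by (simp add: image_comp)
    moreover have "incseq (\<lambda>i. measure (measure_spmf (d i)) A)"
      using ord_spmf_eqD_emeasure[OF inc] by (intro incseq_SucI) (simp add: measure_spmf.emeasure_eq_measure)
    moreover have "bdd_above (range (\<lambda>i. measure (measure_spmf (d i)) A))"
      by (intro bdd_aboveI2[where M = 1]) (simp add: measure_spmf.subprob_measure_le_1)
    ultimately show ?thesis using LIMSEQ_incseq_SUP by metis
  qed
  show ?thesis
  proof (cases x)
    case None
    have "(\<lambda>i. 1 - weight_spmf (d i)) \<longlonglongrightarrow> 1 - weight_spmf (lub_spmf (range d))"
      using meas[of UNIV] by (intro tendsto_intros) (simp add: weight_spmf_def)
    thus ?thesis unfolding None pmf_None_eq_weight_spmf .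
  next
    case (Some y)
    thus ?thesis using meas[of "{y}"] by (simp add: spmf_conv_measure_spmf)
  qed
qed

text \<open>The couplings chosen for successive approximants need not be related to each other;
  compactness extracts a limit coupling obeying the same bound.\<close>

lemma star_inf_lub:
  fixes d1 :: "nat \<Rightarrow> 'a spmf" and d2 :: "nat \<Rightarrow> 'b spmf"
  assumes "\<And>i. ord_spmf (=) (d1 i) (d1 (Suc i))" "\<And>i. ord_spmf (=) (d2 i) (d2 (Suc i))"
    and le: "\<And>i. star_inf \<psi> (d1 i) (d2 i) \<le> c"
  shows "star_inf \<psi> (lub_spmf (range d1)) (lub_spmf (range d2)) \<le> c"
proof -
  have "\<forall>i. \<exists>\<mu>. map_pmf fst \<mu> = d1 i \<and> map_pmf snd \<mu> = d2 i \<and> (\<integral>\<^sup>+p. star_ext \<psi> p \<partial>measure_pmf \<mu>) \<le> c"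
    using le by (auto simp: star_inf_le_iff star_couplings_def)
  from choice[OF this] obtain \<mu> where
    "\<And>i. map_pmf fst (\<mu> i) = d1 i \<and> map_pmf snd (\<mu> i) = d2 i \<and> (\<integral>\<^sup>+p. star_ext \<psi> p \<partial>measure_pmf (\<mu> i)) \<le> c"
    by blast
  hence "\<exists>\<nu>. map_pmf fst \<nu> = lub_spmf (range d1) \<and> map_pmf snd \<nu> = lub_spmf (range d2) \<and>
      (\<integral>\<^sup>+p. star_ext \<psi> p \<partial>measure_pmf \<nu>) \<le> c"
    using assms(1,2)
    by (intro coupling_compactness[where \<mu> = \<mu> and p = d1 and q = d2 and c = "\<lambda>_. c"] pmf_lub_spmf_tendsto) simp_all
  thus ?thesis by (auto simp: star_inf_le_iff star_couplings_def)
qed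

lemma while_approx_mono: "ord_spmf (=) (while_approx g c i m) (while_approx g c (Suc i) m)"
proof (induction i arbitrary: m)
  case (Suc i)
  show ?case
    using ord_spmf_bindI[of "(=)" "c m" "c m" "(=)" "while_approx g c i" "while_approx g c (Suc i)"] Suc
    by (auto simp: ord_spmf_reflI simp del: while_approx.simps(2) simp: while_approx.simps(2)[of g c i] while_approx.simps(2)[of g c "Suc i"])
qed simp

lemma sem_unit_nf: "sem \<E> \<B> \<S> (unit_nf C) = sem \<E> \<B> \<S> C"
proof (induction C)
  case (Seq C D)
  have "sem \<E> \<B> \<S> (seq_unit C' D') = (\<lambda>m. bind_spmf (sem \<E> \<B> \<S> C' m) (sem \<E> \<B> \<S> D'))" for C' D'
    by (auto simp: seq_unit_def)
  thus ?case using Seq by simp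
qed (simp_all cong: if_cong)

lemma guarded_simps [simp]: "True \<triangleright> a = a" "False \<triangleright> a = \<infinity>"
  by (simp_all add: guarded_def)

text \<open>The bound holds for every approximant by induction and passes to the supremum. The zero
  sub-distribution costs 0, and if the guards disagree the right-hand side is infinite.\<close>

lemma star_inf_while:
  assumes body: "\<And>m1 m2. g1 m1 \<Longrightarrow> g2 m2 \<Longrightarrow>
    star_inf (\<lambda>(m1, m2). (g1 m1 \<longleftrightarrow> g2 m2) \<triangleright> \<phi> (m1, m2)) (c1 m1) (c2 m2) \<le> \<phi> (m1, m2)"
  shows "star_inf (\<lambda>(m1, m2). (\<not> g1 m1 \<and> \<not> g2 m2) \<triangleright> \<phi> (m1, m2))
      (lub_spmf (range (\<lambda>i. while_approx g1 c1 i m1))) (lub_spmf (range (\<lambda>i. while_approx g2 c2 i m2)))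
    \<le> (g1 m1 \<longleftrightarrow> g2 m2) \<triangleright> \<phi> (m1, m2)"
proof (rule star_inf_lub)
  let ?\<theta> = "\<lambda>(m1, m2). (g1 m1 \<longleftrightarrow> g2 m2) \<triangleright> \<phi> (m1, m2)"
  let ?\<psi> = "\<lambda>(m1, m2). (\<not> g1 m1 \<and> \<not> g2 m2) \<triangleright> \<phi> (m1, m2)"
  fix i
  show "star_inf ?\<psi> (while_approx g1 c1 i m1) (while_approx g2 c2 i m2) \<le> (g1 m1 \<longleftrightarrow> g2 m2) \<triangleright> \<phi> (m1, m2)"
  proof (induction i arbitrary: m1 m2)
    case (Suc i)
    consider "g1 m1" "g2 m2" | "\<not> g1 m1" "\<not> g2 m2" | "g1 m1 \<noteq> g2 m2" by blast
    thus ?case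
    proof cases
      case 1
      have "star_inf ?\<psi> (bind_spmf (c1 m1) (while_approx g1 c1 i)) (bind_spmf (c2 m2) (while_approx g2 c2 i))
          \<le> star_inf (\<lambda>(a, b). star_inf ?\<psi> (while_approx g1 c1 i a) (while_approx g2 c2 i b)) (c1 m1) (c2 m2)"
        by (rule star_inf_bind)
      also have "\<dots> \<le> star_inf ?\<theta> (c1 m1) (c2 m2)"
        by (rule star_inf_mono) (simp only: prod.case Suc.IH)
      also have "\<dots> \<le> \<phi> (m1, m2)" using 1 by (rule body)
      finally show ?thesis using 1 by simp
    next
      case 2
      thus ?thesis using star_inf_return[of ?\<psi> m1 m2] by simp
    qed simp
  qed simp
qed (rule while_approx_mono)+

lemma star_inf_while_left:
  assumes body: "\<And>m1. g m1 \<Longrightarrow> star_inf \<phi> (c m1) (return_spmf m2) \<le> \<phi> (m1, m2)"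
  shows "star_inf (\<lambda>(m1, m2). (\<not> g m1) \<triangleright> \<phi> (m1, m2))
    (lub_spmf (range (\<lambda>i. while_approx g c i m1))) (return_spmf m2) \<le> \<phi> (m1, m2)"
proof -
  let ?\<psi> = "\<lambda>(m1, m2). (\<not> g m1) \<triangleright> \<phi> (m1, m2)"
  have "star_inf ?\<psi> (while_approx g c i m1) (return_spmf m2) \<le> \<phi> (m1, m2)" for i
  proof (induction i arbitrary: m1)
    case (Suc i)
    show ?case
    proof (cases "g m1")
      case True
      \<comment> \<open>The idle right side is written as a bind so that couplings can be
        composed.\<close>
      have "star_inf ?\<psi> (bind_spmf (c m1) (while_approx g c i)) (bind_spmf (return_spmf m2) return_spmf)
          \<le> star_inf (\<lambda>(a, b). star_inf ?\<psi> (while_approx g c i a) (return_spmf b)) (c m1) (return_spmf m2)"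
        by (rule star_inf_bind)
      also have "\<dots> = star_inf (\<lambda>(a, b). star_inf ?\<psi> (while_approx g c i a) (return_spmf m2)) (c m1) (return_spmf m2)"
        by (rule star_inf_cong) simp
      also have "\<dots> \<le> star_inf (\<lambda>(a, b). \<phi> (a, m2)) (c m1) (return_spmf m2)"
        by (rule star_inf_mono) (simp only: prod.case Suc.IH)
      also have "\<dots> = star_inf \<phi> (c m1) (return_spmf m2)"
        by (rule star_inf_cong) simp
      also have "\<dots> \<le> \<phi> (m1, m2)" using True by (rule body)
      finally show ?thesis using True by simp
    next
      case False
      thus ?thesis using star_inf_return[of ?\<psi> m1 m2] by simp
    qed
  qed simp
  \<comment> \<open>The idle right side enters as a constant chain.\<close>
  hence "star_inf ?\<psi> (lub_spmf (range (\<lambda>i. while_approx g c i m1))) (lub_spmf (range (\<lambda>i::nat. return_spmf m2)))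
      \<le> \<phi> (m1, m2)"
    by (intro star_inf_lub while_approx_mono) (simp_all add: ord_spmf_reflI)
  thus ?thesis by simp
qed

lemma star_inf_while_right:
  assumes body: "\<And>m2. g m2 \<Longrightarrow> star_inf \<phi> (return_spmf m1) (c m2) \<le> \<phi> (m1, m2)"
  shows "star_inf (\<lambda>(m1, m2). (\<not> g m2) \<triangleright> \<phi> (m1, m2))
    (return_spmf m1) (lub_spmf (range (\<lambda>i. while_approx g c i m2))) \<le> \<phi> (m1, m2)"
  using star_inf_while_left[of g "\<lambda>(b, a). \<phi> (a, b)" c m1 m2] body
  by (subst star_inf_swap) (simp add: star_inf_swap[of \<phi>])

lemma star_inf_sample_left:
  "star_inf \<psi> (map_spmf f (spmf_of_pmf p)) (return_spmf b) \<le> (\<integral>\<^sup>+v. \<psi> (f v, b) \<partial>measure_pmf p)"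
  using star_inf_le_coupling[of "map_spmf (\<lambda>v. (f v, b)) (spmf_of_pmf p)" "map_spmf f (spmf_of_pmf p)" "return_spmf b" \<psi>]
  by (simp add: couplings_def pmf.map_comp o_def spmf_of_pmf_def[symmetric])

lemma strassen_star_inf:
  assumes "lossless_spmf d1" "lossless_spmf d2"
    and le: "\<And>M. star_inf (\<lambda>(a, b). of_bool (a \<in> M) + of_bool (b \<notin> R `` M)) d1 d2 \<le> 1 + \<phi>"
  shows "star_inf (\<lambda>(a, b). of_bool ((a, b) \<notin> R)) d1 d2 \<le> \<phi>"
proof -
  obtain p q where pq: "d1 = spmf_of_pmf p" "d2 = spmf_of_pmf q"
    using assms(1,2) by (auto simp: lossless_spmf_conv_spmf_of_pmf)
  have "emeasure p M \<le> emeasure q (R `` M) + \<phi>" for M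
  proof -
    obtain \<mu> where \<mu>: "map_pmf fst \<mu> = p" "map_pmf snd \<mu> = q"
      and c: "(\<integral>\<^sup>+(a, b). of_bool (a \<in> M) + of_bool (b \<notin> R `` M) \<partial>measure_pmf \<mu>) \<le> 1 + \<phi>"
      using le[of M] unfolding pq star_inf_spmf_of_pmf_le_iff by auto
    have "(\<integral>\<^sup>+(a, b). of_bool (a \<in> M) + of_bool (b \<notin> R `` M) \<partial>measure_pmf \<mu>) =
        (\<integral>\<^sup>+x. indicator (fst -` M) x + indicator (snd -` (- (R `` M))) x \<partial>measure_pmf \<mu>)"
      by (intro nn_integral_cong) (auto simp: indicator_def split: prod.split)
    also have "\<dots> = emeasure p M + emeasure q (- (R `` M))"
      by (simp add: nn_integral_add \<mu>[symmetric])
    finally have "emeasure p M + emeasure q (- (R `` M)) \<le> 1 + \<phi>" using c by simp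
    moreover have "emeasure q (R `` M) + emeasure q (- (R `` M)) = 1"
      using plus_emeasure[of "R `` M" "measure_pmf q" "- (R `` M)"] by simp
    ultimately have "emeasure q (- (R `` M)) + emeasure p M \<le> emeasure q (- (R `` M)) + (emeasure q (R `` M) + \<phi>)"
      by (metis add.assoc add.commute)
    thus ?thesis by (simp add: ennreal_add_left_cancel_le)
  qed
  from strassen_defect[of p q R \<phi>, OF this] obtain \<mu> where
    \<mu>: "map_pmf fst \<mu> = p" "map_pmf snd \<mu> = q" "emeasure \<mu> (- R) \<le> \<phi>" by blast
  have "(\<integral>\<^sup>+(a, b). of_bool ((a, b) \<notin> R) \<partial>measure_pmf \<mu>) = (\<integral>\<^sup>+x. indicator (- R) x \<partial>measure_pmf \<mu>)"
    by (intro nn_integral_cong) (auto simp: indicator_def)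
  with \<mu> have "(\<integral>\<^sup>+(a, b). of_bool ((a, b) \<notin> R) \<partial>measure_pmf \<mu>) \<le> \<phi>" by simp
  thus ?thesis unfolding pq star_inf_spmf_of_pmf_le_iff using \<mu> by blast
qed

text \<open>Both indicators on the left can be 1 only if \<open>(a, b)\<close> lies outside
  \<open>R\<close>, so one coupling witnesses both sides pointwise.\<close>

lemma star_inf_strassen_le:
  "star_inf (\<lambda>(a, b). of_bool (a \<in> M) + of_bool (b \<notin> R `` M)) d1 d2
    \<le> 1 + star_inf (\<lambda>(a, b). of_bool ((a, b) \<notin> R)) d1 d2"
proof -
  let ?\<psi> = "\<lambda>(a, b). of_bool ((a, b) \<notin> R) :: ennreal"
  obtain \<mu> where \<mu>: "\<mu> \<in> star_couplings d1 d2" "(\<integral>\<^sup>+p. star_ext ?\<psi> p \<partial>measure_pmf \<mu>) \<le> star_inf ?\<psi> d1 d2"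
    using star_inf_le_iff[of ?\<psi> d1 d2 "star_inf ?\<psi> d1 d2"] by auto
  have "star_ext (\<lambda>(a, b). of_bool (a \<in> M) + of_bool (b \<notin> R `` M)) p \<le> 1 + star_ext ?\<psi> p" for p
    by (auto simp: star_ext_def split: option.splits prod.splits)
  hence "(\<integral>\<^sup>+p. star_ext (\<lambda>(a, b). of_bool (a \<in> M) + of_bool (b \<notin> R `` M)) p \<partial>measure_pmf \<mu>)
      \<le> (\<integral>\<^sup>+p. 1 + star_ext ?\<psi> p \<partial>measure_pmf \<mu>)"
    by (intro nn_integral_mono)
  also have "\<dots> = 1 + (\<integral>\<^sup>+p. star_ext ?\<psi> p \<partial>measure_pmf \<mu>)" by (simp add: nn_integral_add)
  also have "\<dots> \<le> 1 + star_inf ?\<psi> d1 d2" using \<mu>(2) by (rule add_left_mono)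
  finally show ?thesis unfolding star_inf_le_iff[of _ d1 d2] using \<mu>(1) by blast
qed

subsection \<open>Soundness\<close>

theorem erhl_sound:
  assumes "erhl \<E> \<B> \<S> Z \<Phi> C D \<Psi>" "z \<in> Z"
  shows "star_inf (\<Psi> z) (sem \<E> \<B> \<S> C m1) (sem \<E> \<B> \<S> D m2) \<le> \<Phi> z (m1, m2)"
  using assms
proof (induction arbitrary: z m1 m2 rule: erhl.induct)
  case (Unit Z \<Phi> C D \<Psi> C' D')
  thus ?case by (metis sem_unit_nf)
next
  case (Skip Z \<Phi>)
  show ?case by (simp add: star_inf_return)
next
  case (Asgn Z \<Phi> x e y e')
  show ?case by (simp add: star_inf_return)
next
  case (Sample Z \<mu> s s' \<Phi> x y)
  \<comment> \<open>The coupling of the sampled values supplied by the rule, pushed forward along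
    the memory updates.\<close>
  have "map_spmf (\<lambda>(v1, v2). (m1(x := v1), m2(y := v2))) (\<mu> m1 m2)
      \<in> couplings (sem \<E> \<B> \<S> (Sample x s) m1) (sem \<E> \<B> \<S> (Sample y s') m2)"
  proof -
    have "spmf_of_pmf (\<S> s m1) = map_spmf fst (\<mu> m1 m2)" "spmf_of_pmf (\<S> s' m2) = map_spmf snd (\<mu> m1 m2)"
      using Sample.hyps(2)[of m1 m2] by (simp_all add: couplings_def)
    thus ?thesis
      by (simp add: couplings_def pmf.map_comp option.map_comp o_def split_beta del: map_spmf_of_pmf)
  qed
  from star_inf_le_coupling[OF this, of "\<Phi> z"]
  show ?case by (simp add: o_def case_prod_unfold)
next
  case (If Z b b' \<Phi> C1 D1 \<Psi> C2 D2)
  consider "\<B> b m1" "\<B> b' m2" | "\<not> \<B> b m1" "\<not> \<B> b' m2" | "\<B> b m1 \<noteq> \<B> b' m2" by blast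
  thus ?case
  proof cases
    case 1
    thus ?thesis using If.IH(1)[OF If.prems, of m1 m2] by simp
  next
    case 2
    thus ?thesis using If.IH(2)[OF If.prems, of m1 m2] by simp
  qed simp
next
  case (While Z b b' \<Phi> C D)
  have "star_inf (\<lambda>(m1, m2). (\<B> b m1 \<longleftrightarrow> \<B> b' m2) \<triangleright> \<Phi> z (m1, m2)) (sem \<E> \<B> \<S> C m1) (sem \<E> \<B> \<S> D m2) \<le> \<Phi> z (m1, m2)"
    if "\<B> b m1" "\<B> b' m2" for m1 m2
    using While.IH[OF While.prems, of m1 m2] that by simp
  from star_inf_while[of "\<B> b" "\<B> b'" "\<Phi> z", OF this] show ?case by simp
next
  case (Seq Z \<Phi> C1 D1 \<Theta> C2 D2 \<Psi>)
  have "star_inf (\<Psi> z) (sem \<E> \<B> \<S> (Seq C1 C2) m1) (sem \<E> \<B> \<S> (Seq D1 D2) m2) \<le>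
      star_inf (\<lambda>(a, b). star_inf (\<Psi> z) (sem \<E> \<B> \<S> C2 a) (sem \<E> \<B> \<S> D2 b)) (sem \<E> \<B> \<S> C1 m1) (sem \<E> \<B> \<S> D1 m2)"
    by (simp add: star_inf_bind)
  also have "\<dots> \<le> star_inf (\<Theta> z) (sem \<E> \<B> \<S> C1 m1) (sem \<E> \<B> \<S> D1 m2)"
    by (rule star_inf_mono) (simp add: Seq)
  also have "\<dots> \<le> \<Phi> z (m1, m2)" by (rule Seq.IH(1)[OF Seq.prems])
  finally show ?case .
next
  case (Asgn_L Z \<Phi> x e)
  show ?case by (simp add: star_inf_return)
next
  case (Asgn_R Z \<Phi> x e)
  show ?case by (simp add: star_inf_return)
next
  case (Sample_L Z s \<Phi> x)
  show ?case using star_inf_sample_left[of "\<Phi> z"] by (simp del: map_spmf_of_pmf)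
next
  case (Sample_R Z s \<Phi> x)
  show ?case
    using star_inf_sample_left[of "\<lambda>(b, a). \<Phi> z (a, b)" "\<lambda>v. m2(x := v)" "\<S> s m2" m1]
    by (subst star_inf_swap) (simp del: map_spmf_of_pmf)
next
  case (If_L Z b \<Phi> C1 \<Psi> C2)
  show ?case
    using If_L.IH(1)[OF If_L.prems, of m1 m2] If_L.IH(2)[OF If_L.prems, of m1 m2] by (cases "\<B> b m1") simp_all
next
  case (If_R Z b \<Phi> D1 \<Psi> D2)
  show ?case
    using If_R.IH(1)[OF If_R.prems, of m1 m2] If_R.IH(2)[OF If_R.prems, of m1 m2] by (cases "\<B> b m2") simp_all
next
  case (While_L Z b \<Phi> C)
  have "star_inf (\<Phi> z) (sem \<E> \<B> \<S> C m1) (return_spmf m2) \<le> \<Phi> z (m1, m2)" if "\<B> b m1" for m1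
    using While_L.IH[OF While_L.prems, of m1 m2] that by simp
  from star_inf_while_left[of "\<B> b" "\<Phi> z", OF this] show ?case by simp
next
  case (While_R Z b \<Phi> D)
  have "star_inf (\<Phi> z) (return_spmf m1) (sem \<E> \<B> \<S> D m2) \<le> \<Phi> z (m1, m2)" if "\<B> b m2" for m2
    using While_R.IH[OF While_R.prems, of m1 m2] that by simp
  from star_inf_while_right[of "\<B> b" "\<Phi> z", OF this] show ?case by simp
next
  case (Conseq Z' \<Phi>' C D \<Psi>' Z \<Phi> \<Psi>)
  \<comment> \<open>The side condition covers all sub-distributions; it is applied to the two output
    distributions, for which the induction hypothesis is its premise.\<close>
  thus ?case by blast
next
  case (Nmod_L x C Z \<Phi> D \<Psi>)
  \<comment> \<open>Choosing the initial value of \<open>x\<close> as logical variable makes the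
    guard of the premise true; since \<open>x\<close> is preserved, the update in the post-assertion
    is then the identity on the support.\<close>
  have "star_inf (\<lambda>(m1', m2'). \<Psi> z (m1'(x := m1 x), m2')) (sem \<E> \<B> \<S> C m1) (sem \<E> \<B> \<S> D m2) \<le> \<Phi> z (m1, m2)"
    using Nmod_L.IH[of "LVal (m1 x) z" m1 m2] Nmod_L.prems by simp
  also have "star_inf (\<lambda>(m1', m2'). \<Psi> z (m1'(x := m1 x), m2')) (sem \<E> \<B> \<S> C m1) (sem \<E> \<B> \<S> D m2)
      = star_inf (\<Psi> z) (sem \<E> \<B> \<S> C m1) (sem \<E> \<B> \<S> D m2)"
  proof (rule star_inf_cong)
    fix a b assume "a \<in> set_spmf (sem \<E> \<B> \<S> C m1)"
    hence "a x = m1 x" using Nmod_L.hyps by (simp add: not_modified_def)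
    hence "a(x := m1 x) = a" by (metis fun_upd_triv)
    thus "(case (a, b) of (m1', m2') \<Rightarrow> \<Psi> z (m1'(x := m1 x), m2')) = \<Psi> z (a, b)" by simp
  qed
  finally show ?case .
next
  case (Nmod_R x D Z \<Phi> C \<Psi>)
  have "star_inf (\<lambda>(m1', m2'). \<Psi> z (m1', m2'(x := m2 x))) (sem \<E> \<B> \<S> C m1) (sem \<E> \<B> \<S> D m2) \<le> \<Phi> z (m1, m2)"
    using Nmod_R.IH[of "LVal (m2 x) z" m1 m2] Nmod_R.prems by simp
  also have "star_inf (\<lambda>(m1', m2'). \<Psi> z (m1', m2'(x := m2 x))) (sem \<E> \<B> \<S> C m1) (sem \<E> \<B> \<S> D m2)
      = star_inf (\<Psi> z) (sem \<E> \<B> \<S> C m1) (sem \<E> \<B> \<S> D m2)"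
  proof (rule star_inf_cong)
    fix a b assume "b \<in> set_spmf (sem \<E> \<B> \<S> D m2)"
    hence "b x = m2 x" using Nmod_R.hyps by (simp add: not_modified_def)
    hence "b(x := m2 x) = b" by (metis fun_upd_triv)
    thus "(case (a, b) of (m1', m2') \<Rightarrow> \<Psi> z (m1', m2'(x := m2 x))) = \<Psi> z (a, b)" by simp
  qed
  finally show ?case .
next
  case (Strassen_to_sets C D Z \<Phi> R)
  then obtain M z' where z: "z = LSet M z'" "z' \<in> Z" by blast
  have "star_inf (\<lambda>(a, b). of_bool (a \<in> M) + of_bool (b \<notin> R z' `` M)) (sem \<E> \<B> \<S> C m1) (sem \<E> \<B> \<S> D m2)
      \<le> 1 + star_inf (\<lambda>(a, b). of_bool ((a, b) \<notin> R z')) (sem \<E> \<B> \<S> C m1) (sem \<E> \<B> \<S> D m2)"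
    by (rule star_inf_strassen_le)
  also have "\<dots> \<le> 1 + \<Phi> z' (m1, m2)" by (intro add_left_mono Strassen_to_sets.IH z)
  finally show ?case by (simp add: z)
next
  case (Strassen_from_sets C D Z \<Phi> R)
  show ?case
  proof (rule strassen_star_inf)
    show "lossless_spmf (sem \<E> \<B> \<S> C m1)" "lossless_spmf (sem \<E> \<B> \<S> D m2)"
      using Strassen_from_sets.hyps by (simp_all add: ast_def)
    fix M
    show "star_inf (\<lambda>(a, b). of_bool (a \<in> M) + of_bool (b \<notin> R z `` M)) (sem \<E> \<B> \<S> C m1) (sem \<E> \<B> \<S> D m2)
      \<le> 1 + \<Phi> z (m1, m2)"
      using Strassen_from_sets.IH[of "LSet M z" m1 m2] Strassen_from_sets.prems by simp
  qed
qed

subsection \<open>Weakest preconditions\<close>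

lemma nn_integral_bind_spmf:
  "(\<integral>\<^sup>+x. f x \<partial>measure_spmf (bind_spmf p g)) = (\<integral>\<^sup>+y. \<integral>\<^sup>+x. f x \<partial>measure_spmf (g y) \<partial>measure_spmf p)"
  by (simp add: measure_spmf_bind o_def) (subst nn_integral_bind[where B = "count_space UNIV"], auto simp: space_measure_spmf)

lemma nn_integral_lub_spmf:
  fixes d :: "nat \<Rightarrow> 'a spmf"
  assumes inc: "\<And>i. ord_spmf (=) (d i) (d (Suc i))"
  shows "(\<integral>\<^sup>+x. f x \<partial>measure_spmf (lub_spmf (range d))) = (SUP i. \<integral>\<^sup>+x. f x \<partial>measure_spmf (d i))"
proof -
  note le = ord_spmf_increasing(1)[of d, OF inc] and chain = ord_spmf_increasing(2)[of d, OF inc]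
  have "(\<integral>\<^sup>+x. f x \<partial>measure_spmf (lub_spmf (range d))) =
      (\<integral>\<^sup>+x. (SUP i. ennreal (spmf (d i) x) * f x) \<partial>count_space UNIV)"
    by (simp add: nn_integral_measure_spmf ennreal_spmf_lub_spmf[OF chain] image_comp SUP_mult_right_ennreal)
  also have "\<dots> = (SUP i. \<integral>\<^sup>+x. ennreal (spmf (d i) x) * f x \<partial>count_space UNIV)"
    using le
    by (intro nn_integral_monotone_convergence_SUP)
      (auto simp: incseq_def le_fun_def intro!: mult_right_mono ennreal_leI ord_spmf_eq_leD)
  finally show ?thesis by (simp add: nn_integral_measure_spmf)
qed

text \<open>The fixed-point equation of the loop's expectation, obtained by monotone convergence. It
  makes this expectation a loop invariant in the weakest precondition proofs.\<close>

lemma nn_integral_while: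
  "(\<integral>\<^sup>+x. f x \<partial>measure_spmf (sem \<E> \<B> \<S> (While b C) m)) =
    (if \<B> b m then \<integral>\<^sup>+m'. \<integral>\<^sup>+x. f x \<partial>measure_spmf (sem \<E> \<B> \<S> (While b C) m') \<partial>measure_spmf (sem \<E> \<B> \<S> C m) else f m)"
proof -
  let ?w = "\<lambda>i m. while_approx (\<B> b) (sem \<E> \<B> \<S> C) i m"
  let ?W = "\<lambda>i m. \<integral>\<^sup>+x. f x \<partial>measure_spmf (?w i m)"
  have W: "(\<integral>\<^sup>+x. f x \<partial>measure_spmf (sem \<E> \<B> \<S> (While b C) m)) = (SUP i. ?W i m)" for m
    by (simp add: nn_integral_lub_spmf[of "\<lambda>i. ?w i m", OF while_approx_mono])
  have inc: "incseq ?W"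
    by (intro incseq_SucI le_funI)
      (auto simp: nn_integral_measure_spmf simp del: while_approx.simps
        intro!: nn_integral_mono mult_right_mono ennreal_leI ord_spmf_eq_leD while_approx_mono)
  \<comment> \<open>Dropping the first approximant leaves the supremum unchanged, and the shifted
    approximants can be unfolded once.\<close>
  have "(SUP i. ?W i m) = (SUP i. ?W (Suc i) m)"
  proof (rule SUP_eq)
    fix i
    show "\<exists>j\<in>UNIV. ?W i m \<le> ?W (Suc j) m"
      using le_funD[OF incseq_SucD[OF inc, of i], of m] by (intro bexI[of _ i]) simp_all
    show "\<exists>j\<in>UNIV. ?W (Suc i) m \<le> ?W j m"
      by (intro bexI[of _ "Suc i"]) simp_all
  qed
  also have "\<dots> = (if \<B> b m then SUP i. \<integral>\<^sup>+m'. ?W i m' \<partial>measure_spmf (sem \<E> \<B> \<S> C m) else f m)"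
    by (simp add: nn_integral_bind_spmf measure_spmf_return_spmf nn_integral_return)
  also have "(SUP i. \<integral>\<^sup>+m'. ?W i m' \<partial>measure_spmf (sem \<E> \<B> \<S> C m)) = (\<integral>\<^sup>+m'. (SUP i. ?W i m') \<partial>measure_spmf (sem \<E> \<B> \<S> C m))"
    using inc by (intro nn_integral_monotone_convergence_SUP[symmetric]) auto
  finally show ?thesis unfolding W .
qed

text \<open>The ordinary consequence rule. The side condition of \<open>Conseq\<close> holds with
  equal index sets because \<open>star_inf\<close> is monotone in the assertion.\<close>

lemma erhl_weaken:
  assumes "erhl \<E> \<B> \<S> Z \<Phi>' C D \<Psi>'" "Z \<noteq> {}"
    and pre: "\<And>z m1 m2. z \<in> Z \<Longrightarrow> \<Phi>' z (m1, m2) \<le> \<Phi> z (m1, m2)"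
    and post: "\<And>z m1 m2. z \<in> Z \<Longrightarrow> \<Psi> z (m1, m2) \<le> \<Psi>' z (m1, m2)"
  shows "erhl \<E> \<B> \<S> Z \<Phi> C D \<Psi>"
  using assms(1,2)
proof (rule Conseq)
  fix m1 m2 :: "'b \<Rightarrow> 'c" and d1 d2 :: "('b \<Rightarrow> 'c) spmf"
  assume *: "\<forall>z'\<in>Z. star_inf (\<Psi>' z') d1 d2 \<le> \<Phi>' z' (m1, m2)"
  show "\<forall>z\<in>Z. star_inf (\<Psi> z) d1 d2 \<le> \<Phi> z (m1, m2)"
  proof
    fix z assume z: "z \<in> Z"
    have "star_inf (\<Psi> z) d1 d2 \<le> star_inf (\<Psi>' z) d1 d2" using post[OF z] by (rule star_inf_mono)
    also have "\<dots> \<le> \<Phi>' z (m1, m2)" using * z by blast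
    also have "\<dots> \<le> \<Phi> z (m1, m2)" using z by (rule pre)
    finally show "star_inf (\<Psi> z) d1 d2 \<le> \<Phi> z (m1, m2)" .
  qed
qed

lemma erhl_wp_left:
  assumes Z: "Z \<noteq> {}"
  shows "erhl \<E> \<B> \<S> Z (\<lambda>z (m1, m2). \<integral>\<^sup>+m. \<Psi> z (m, m2) \<partial>measure_spmf (sem \<E> \<B> \<S> C m1)) C Skip \<Psi>"
proof (induction C arbitrary: \<Psi>)
  case Skip
  show ?case by (rule erhl_weaken[OF erhl.Skip[OF Z, where \<Phi> = \<Psi>] Z]) (simp_all add: measure_spmf_return_spmf nn_integral_return)
next
  case (Assign x e)
  show ?case by (rule erhl_weaken[OF erhl.Asgn_L[OF Z, where \<Phi> = \<Psi>] Z]) (simp_all add: measure_spmf_return_spmf nn_integral_return)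
next
  case (Sample x s)
  show ?case by (rule erhl_weaken[OF erhl.Sample_L[OF Z, where \<Phi> = \<Psi>] Z]) simp_all
next
  case (Seq C1 C2)
  \<comment> \<open>Composition leaves \<open>Seq Skip Skip\<close> on the idle side, which
    \<open>Unit\<close> contracts.\<close>
  have "erhl \<E> \<B> \<S> Z (\<lambda>z (m1, m2). \<integral>\<^sup>+m. \<Psi> z (m, m2) \<partial>measure_spmf (sem \<E> \<B> \<S> (Seq C1 C2) m1)) (Seq C1 C2) (Seq Skip Skip) \<Psi>"
    by (rule erhl_weaken[OF erhl.Seq[OF Seq.IH(1) Seq.IH(2)[of \<Psi>]] Z]) (simp_all add: nn_integral_bind_spmf)
  thus ?case by (rule erhl.Unit) (simp_all add: seq_unit_def)
next
  case (Cond b C1 C2)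
  show ?case
    by (rule erhl.If_L; rule erhl_weaken[OF Cond.IH(1)[of \<Psi>] Z] erhl_weaken[OF Cond.IH(2)[of \<Psi>] Z]) (auto simp: guarded_def)
next
  case (While b C)
  \<comment> \<open>The weakest precondition of the loop is its own invariant: under the guard it
    unfolds through the body, and otherwise it is \<open>\<Psi>\<close>.\<close>
  let ?\<Phi> = "\<lambda>z (m1, m2). \<integral>\<^sup>+m. \<Psi> z (m, m2) \<partial>measure_spmf (sem \<E> \<B> \<S> (While b C) m1)"
  have unfold: "?\<Phi> z (m1, m2) = (if \<B> b m1 then \<integral>\<^sup>+m. ?\<Phi> z (m, m2) \<partial>measure_spmf (sem \<E> \<B> \<S> C m1) else \<Psi> z (m1, m2))"
    for z m1 m2
    unfolding prod.case by (rule nn_integral_while)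
  have "erhl \<E> \<B> \<S> Z (\<lambda>z (m1, m2). \<B> b m1 \<triangleright> ?\<Phi> z (m1, m2)) C Skip ?\<Phi>"
  proof (rule erhl_weaken[OF While.IH[of ?\<Phi>] Z])
    fix z m1 m2
    show "(case (m1, m2) of (m1, m2) \<Rightarrow> \<integral>\<^sup>+m. ?\<Phi> z (m, m2) \<partial>measure_spmf (sem \<E> \<B> \<S> C m1))
        \<le> (case (m1, m2) of (m1, m2) \<Rightarrow> \<B> b m1 \<triangleright> ?\<Phi> z (m1, m2))"
      unfolding prod.case[of _ m1 m2] using unfold[of z m1 m2] by (cases "\<B> b m1") (simp_all del: sem.simps)
  qed simp
  from erhl.While_L[OF this] show ?case
  proof (rule erhl_weaken[OF _ Z])
    fix z m1 m2
    show "\<Psi> z (m1, m2) \<le> (case (m1, m2) of (m1, m2) \<Rightarrow> (\<not> \<B> b m1) \<triangleright> ?\<Phi> z (m1, m2))"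
      using unfold[of z m1 m2] by (cases "\<B> b m1") (simp_all del: sem.simps)
  qed simp
qed

lemma erhl_wp_right:
  assumes Z: "Z \<noteq> {}"
  shows "erhl \<E> \<B> \<S> Z (\<lambda>z (m1, m2). \<integral>\<^sup>+m. \<Psi> z (m1, m) \<partial>measure_spmf (sem \<E> \<B> \<S> D m2)) Skip D \<Psi>"
proof (induction D arbitrary: \<Psi>)
  case Skip
  show ?case by (rule erhl_weaken[OF erhl.Skip[OF Z, where \<Phi> = \<Psi>] Z]) (simp_all add: measure_spmf_return_spmf nn_integral_return)
next
  case (Assign x e)
  show ?case by (rule erhl_weaken[OF erhl.Asgn_R[OF Z, where \<Phi> = \<Psi>] Z]) (simp_all add: measure_spmf_return_spmf nn_integral_return)
next
  case (Sample x s)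
  show ?case by (rule erhl_weaken[OF erhl.Sample_R[OF Z, where \<Phi> = \<Psi>] Z]) simp_all
next
  case (Seq D1 D2)
  have "erhl \<E> \<B> \<S> Z (\<lambda>z (m1, m2). \<integral>\<^sup>+m. \<Psi> z (m1, m) \<partial>measure_spmf (sem \<E> \<B> \<S> (Seq D1 D2) m2)) (Seq Skip Skip) (Seq D1 D2) \<Psi>"
    by (rule erhl_weaken[OF erhl.Seq[OF Seq.IH(1) Seq.IH(2)[of \<Psi>]] Z]) (simp_all add: nn_integral_bind_spmf)
  thus ?case by (rule erhl.Unit) (simp_all add: seq_unit_def)
next
  case (Cond b D1 D2)
  show ?case
    by (rule erhl.If_R; rule erhl_weaken[OF Cond.IH(1)[of \<Psi>] Z] erhl_weaken[OF Cond.IH(2)[of \<Psi>] Z]) (auto simp: guarded_def)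
next
  case (While b D)
  let ?\<Phi> = "\<lambda>z (m1, m2). \<integral>\<^sup>+m. \<Psi> z (m1, m) \<partial>measure_spmf (sem \<E> \<B> \<S> (While b D) m2)"
  have unfold: "?\<Phi> z (m1, m2) = (if \<B> b m2 then \<integral>\<^sup>+m. ?\<Phi> z (m1, m) \<partial>measure_spmf (sem \<E> \<B> \<S> D m2) else \<Psi> z (m1, m2))"
    for z m1 m2
    unfolding prod.case by (rule nn_integral_while)
  have "erhl \<E> \<B> \<S> Z (\<lambda>z (m1, m2). \<B> b m2 \<triangleright> ?\<Phi> z (m1, m2)) Skip D ?\<Phi>"
  proof (rule erhl_weaken[OF While.IH[of ?\<Phi>] Z])
    fix z m1 m2
    show "(case (m1, m2) of (m1, m2) \<Rightarrow> \<integral>\<^sup>+m. ?\<Phi> z (m1, m) \<partial>measure_spmf (sem \<E> \<B> \<S> D m2))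
        \<le> (case (m1, m2) of (m1, m2) \<Rightarrow> \<B> b m2 \<triangleright> ?\<Phi> z (m1, m2))"
      unfolding prod.case[of _ m1 m2] using unfold[of z m1 m2] by (cases "\<B> b m2") (simp_all del: sem.simps)
  qed simp
  from erhl.While_R[OF this] show ?case
  proof (rule erhl_weaken[OF _ Z])
    fix z m1 m2
    show "\<Psi> z (m1, m2) \<le> (case (m1, m2) of (m1, m2) \<Rightarrow> (\<not> \<B> b m2) \<triangleright> ?\<Phi> z (m1, m2))"
      using unfold[of z m1 m2] by (cases "\<B> b m2") (simp_all del: sem.simps)
  qed simp
qed

theorem erhl_wp:
  assumes Z: "Z \<noteq> {}"
  shows "erhl \<E> \<B> \<S> Z (\<lambda>z (m1, m2). \<integral>\<^sup>+m1'. \<integral>\<^sup>+m2'. \<Psi> z (m1', m2')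
    \<partial>measure_spmf (sem \<E> \<B> \<S> D m2) \<partial>measure_spmf (sem \<E> \<B> \<S> C m1)) C D \<Psi>"
proof -
  from erhl.Seq[OF erhl_wp_left[OF Z] erhl_wp_right[OF Z]]
  have "erhl \<E> \<B> \<S> Z (\<lambda>z (m1, m2). \<integral>\<^sup>+m1'. \<integral>\<^sup>+m2'. \<Psi> z (m1', m2')
    \<partial>measure_spmf (sem \<E> \<B> \<S> D m2) \<partial>measure_spmf (sem \<E> \<B> \<S> C m1)) (Seq C Skip) (Seq Skip D) \<Psi>"
    by simp
  thus ?thesis by (rule erhl.Unit) (simp_all add: seq_unit_def)
qed

subsection \<open>Kantorovich distance\<close>

text \<open>By linearity the expectation depends on the marginals only, so all couplings of
  \<open>p\<close> and \<open>q\<close> give the same value. Adding \<open>h\<close> keeps the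
  integrand nonnegative, which turns it into a Bochner integral.\<close>

lemma nn_integral_lipschitz_coupling:
  assumes f: "f \<in> lipschitz1 \<delta>" and h: "\<And>x y. \<delta> x y \<le> h"
    and \<mu>: "map_pmf fst \<mu> = p" "map_pmf snd \<mu> = q"
  shows "(\<integral>\<^sup>+(a, b). ennreal (f a - f b + h) \<partial>measure_pmf \<mu>) =
    ennreal (measure_pmf.expectation p f - measure_pmf.expectation q f + h)"
proof -
  have diff: "\<bar>f a - f b\<bar> \<le> h" for a b
    using f h[of a b] unfolding lipschitz1_def by (smt (verit) mem_Collect_eq)
  \<comment> \<open>Any fixed reference point would do; boundedness of \<open>f\<close> gives the
    integrability used below.\<close>
  have bnd: "\<bar>f a\<bar> \<le> \<bar>f undefined\<bar> + h" for a
    using diff[of a undefined] by linarith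
  have int: "integrable (measure_pmf \<mu>) (\<lambda>x. f (g x))" for g
    using bnd by (intro measure_pmf.integrable_const_bound[where B = "\<bar>f undefined\<bar> + h"]) auto
  have "(\<integral>\<^sup>+(a, b). ennreal (f a - f b + h) \<partial>measure_pmf \<mu>) = (\<integral>\<^sup>+x. ennreal (f (fst x) - f (snd x) + h) \<partial>measure_pmf \<mu>)"
    by (simp add: case_prod_unfold)
  also have "\<dots> = ennreal (measure_pmf.expectation \<mu> (\<lambda>x. f (fst x) - f (snd x) + h))"
  proof (rule nn_integral_eq_integral)
    have "0 \<le> f a - f b + h" for a b using diff[of a b] by linarith
    thus "AE x in measure_pmf \<mu>. 0 \<le> f (fst x) - f (snd x) + h" by simp
  qed (intro Bochner_Integration.integrable_add Bochner_Integration.integrable_diff int, simp)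
  also have "measure_pmf.expectation \<mu> (\<lambda>x. f (fst x) - f (snd x) + h) =
      measure_pmf.expectation \<mu> (\<lambda>x. f (fst x)) - measure_pmf.expectation \<mu> (\<lambda>x. f (snd x)) + h"
    using int[of fst] int[of snd] by simp
  finally show ?thesis unfolding \<mu>[symmetric] by simp
qed

theorem theorem5p12:
  fixes \<E> :: "'e \<Rightarrow> ('x::countable, 'v::countable) mem \<Rightarrow> 'v"
    and \<B> :: "'b \<Rightarrow> ('x, 'v) mem \<Rightarrow> bool"
    and \<S> :: "'s \<Rightarrow> ('x, 'v) mem \<Rightarrow> 'v pmf"
    and C D :: "('x, 'e, 'b, 's) stmt"
    and R :: "(('x, 'v) mem \<times> ('x, 'v) mem) set"
    and \<Phi> :: "('x, 'v) mem \<times> ('x, 'v) mem \<Rightarrow> ennreal"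
    and \<delta> :: "('x, 'v) mem \<Rightarrow> ('x, 'v) mem \<Rightarrow> real"
    and h :: real
  assumes "ast \<E> \<B> \<S> C" and "ast \<E> \<B> \<S> D"
    and "0 \<le> h"
    and "Metric_space UNIV \<delta>"
    and "\<And>m1 m2. \<delta> m1 m2 \<le> h"
  shows "erhl \<E> \<B> \<S> (LFun ` lipschitz1 \<delta> :: ('x, 'v, 'u) logvar set)
           (\<lambda>z (m1, m2). ((m1, m2) \<in> R) \<triangleright> (\<Phi> (m1, m2) + ennreal h))
           C D
           (\<lambda>z (m1, m2). ennreal (lfun z m1 - lfun z m2 + h))
         \<longleftrightarrow>
         (\<forall>(m1, m2) \<in> R. kantorovich \<delta> (sem \<E> \<B> \<S> C m1) (sem \<E> \<B> \<S> D m2) \<le> \<Phi> (m1, m2))"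
    (is "?derivable \<longleftrightarrow> ?bounded")
proof
  interpret Metric_space UNIV \<delta> by fact
  assume der: ?derivable
  show ?bounded
  proof (intro ballI, clarify)
    fix m1 m2 assume R: "(m1, m2) \<in> R"
    obtain p q where pq: "sem \<E> \<B> \<S> C m1 = spmf_of_pmf p" "sem \<E> \<B> \<S> D m2 = spmf_of_pmf q"
      using assms(1,2) by (metis ast_def lossless_spmf_conv_spmf_of_pmf)
    obtain \<mu> f where \<mu>: "map_pmf fst \<mu> = p" "map_pmf snd \<mu> = q" and f: "f \<in> lipschitz1 \<delta>"
      and tight: "\<And>a b. (a, b) \<in> set_pmf \<mu> \<Longrightarrow> f a - f b = \<delta> a b"
      using kantorovich_potential[OF assms(4,5)] by blast
    have "star_inf (\<lambda>(m1, m2). ennreal (f m1 - f m2 + h)) (spmf_of_pmf p) (spmf_of_pmf q) \<le> \<Phi> (m1, m2) + ennreal h"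
      using erhl_sound[OF der, of "LFun f" m1 m2] f R by (simp add: pq)
    then obtain \<nu> where \<nu>: "map_pmf fst \<nu> = p" "map_pmf snd \<nu> = q"
      and le: "(\<integral>\<^sup>+(a, b). ennreal (f a - f b + h) \<partial>measure_pmf \<nu>) \<le> \<Phi> (m1, m2) + ennreal h"
      unfolding star_inf_spmf_of_pmf_le_iff by auto
    have "(\<integral>\<^sup>+(a, b). ennreal (\<delta> a b) \<partial>measure_pmf \<mu>) + ennreal h
        = (\<integral>\<^sup>+x. ennreal (\<delta> (fst x) (snd x)) + ennreal h \<partial>measure_pmf \<mu>)"
      by (simp add: nn_integral_add case_prod_unfold)
    also have "\<dots> = (\<integral>\<^sup>+(a, b). ennreal (f a - f b + h) \<partial>measure_pmf \<mu>)"
      using tight \<open>0 \<le> h\<close> by (intro nn_integral_cong_AE AE_pmfI) (auto simp: ennreal_plus[symmetric] simp del: ennreal_plus)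
    \<comment> \<open>The coupling \<open>\<nu>\<close> behind the judgment at \<open>f\<close> may
      differ from the optimal \<open>\<mu>\<close>, but the expectation is the same.\<close>
    also have "\<dots> = (\<integral>\<^sup>+(a, b). ennreal (f a - f b + h) \<partial>measure_pmf \<nu>)"
      unfolding nn_integral_lipschitz_coupling[OF f assms(5) \<mu>] nn_integral_lipschitz_coupling[OF f assms(5) \<nu>] ..
    also note le
    finally have "(\<integral>\<^sup>+(a, b). ennreal (\<delta> a b) \<partial>measure_pmf \<mu>) \<le> \<Phi> (m1, m2)"
      by (simp add: add.commute[of _ "ennreal h"] ennreal_add_left_cancel_le)
    moreover have "spmf_of_pmf \<mu> \<in> couplings (spmf_of_pmf p) (spmf_of_pmf q)"
      using \<mu> by (simp add: couplings_def)
    ultimately show "kantorovich \<delta> (sem \<E> \<B> \<S> C m1) (sem \<E> \<B> \<S> D m2) \<le> \<Phi> (m1, m2)"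
      unfolding kantorovich_def pq by (intro INF_lower2[of "spmf_of_pmf \<mu>"]) simp_all
  qed
next
  interpret Metric_space UNIV \<delta> by fact
  assume W: ?bounded
  have "(\<lambda>_. 0) \<in> lipschitz1 \<delta>" by (simp add: lipschitz1_def)
  hence Z: "LFun ` lipschitz1 \<delta> \<noteq> ({} :: ('x, 'v, 'u) logvar set)" by blast
  show ?derivable
  proof (rule erhl_weaken[OF erhl_wp[OF Z] Z])
    fix z :: "('x, 'v, 'u) logvar" and m1 m2
    assume "z \<in> LFun ` lipschitz1 \<delta>"
    then obtain f where z: "z = LFun f" and f: "f \<in> lipschitz1 \<delta>" by blast
    show "(case (m1, m2) of (m1, m2) \<Rightarrow> \<integral>\<^sup>+m1'. \<integral>\<^sup>+m2'. (case (m1', m2') of (m1, m2) \<Rightarrow> ennreal (lfun z m1 - lfun z m2 + h))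
        \<partial>measure_spmf (sem \<E> \<B> \<S> D m2) \<partial>measure_spmf (sem \<E> \<B> \<S> C m1))
      \<le> (case (m1, m2) of (m1, m2) \<Rightarrow> ((m1, m2) \<in> R) \<triangleright> (\<Phi> (m1, m2) + ennreal h))"
    proof (cases "(m1, m2) \<in> R")
      case True
      obtain p q where pq: "sem \<E> \<B> \<S> C m1 = spmf_of_pmf p" "sem \<E> \<B> \<S> D m2 = spmf_of_pmf q"
        using assms(1,2) by (metis ast_def lossless_spmf_conv_spmf_of_pmf)
      \<comment> \<open>Passing through \<open>star_inf\<close> yields a coupling that attains the
        bound, where the Kantorovich distance is given only as an infimum.\<close>
      have "star_inf (\<lambda>(a, b). ennreal (\<delta> a b)) (sem \<E> \<B> \<S> C m1) (sem \<E> \<B> \<S> D m2)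
          \<le> kantorovich \<delta> (sem \<E> \<B> \<S> C m1) (sem \<E> \<B> \<S> D m2)"
        unfolding kantorovich_def by (rule INF_greatest) (rule star_inf_le_coupling)
      also have "\<dots> \<le> \<Phi> (m1, m2)" using W True by blast
      finally obtain \<mu> where \<mu>: "map_pmf fst \<mu> = p" "map_pmf snd \<mu> = q"
        and le: "(\<integral>\<^sup>+(a, b). ennreal (\<delta> a b) \<partial>measure_pmf \<mu>) \<le> \<Phi> (m1, m2)"
        unfolding pq star_inf_spmf_of_pmf_le_iff by auto
      have "(\<integral>\<^sup>+a. \<integral>\<^sup>+b. ennreal (f a - f b + h) \<partial>measure_pmf q \<partial>measure_pmf p)
          = (\<integral>\<^sup>+(a, b). ennreal (f a - f b + h) \<partial>measure_pmf (pair_pmf p q))"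
        by (simp add: nn_integral_pair_pmf')
      \<comment> \<open>The independent coupling from the weakest precondition is exchanged for
        \<open>\<mu>\<close>, on which the cost is controlled.\<close>
      also have "\<dots> = (\<integral>\<^sup>+(a, b). ennreal (f a - f b + h) \<partial>measure_pmf \<mu>)"
        unfolding nn_integral_lipschitz_coupling[OF f assms(5) \<mu>]
        by (rule nn_integral_lipschitz_coupling[OF f assms(5)]) (simp_all add: map_fst_pair_pmf map_snd_pair_pmf)
      also have "\<dots> \<le> (\<integral>\<^sup>+x. ennreal (\<delta> (fst x) (snd x)) + ennreal h \<partial>measure_pmf \<mu>)"
      proof (rule nn_integral_mono, clarify)
        fix a b
        have "f a - f b \<le> \<delta> a b" using f unfolding lipschitz1_def by (smt (verit) mem_Collect_eq)
        thus "ennreal (f a - f b + h) \<le> ennreal (\<delta> (fst (a, b)) (snd (a, b))) + ennreal h"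
          using \<open>0 \<le> h\<close> by (simp add: ennreal_plus[symmetric] ennreal_leI del: ennreal_plus)
      qed
      also have "\<dots> = (\<integral>\<^sup>+(a, b). ennreal (\<delta> a b) \<partial>measure_pmf \<mu>) + ennreal h"
        by (simp add: nn_integral_add case_prod_unfold)
      also have "\<dots> \<le> \<Phi> (m1, m2) + ennreal h" using le by (rule add_right_mono)
      finally show ?thesis using True by (simp add: pq z)
    qed simp
  qed simp
qed

end
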